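(* Let $N\ge1$, let $B$ be the open unit ball of $\mathbb{R}^N$, let $p>1$ and let $f(u)=u^p$ for $u>0$. Then the unique positive large solution $u$ of $\Delta u=f(u)$ in $B$ satisfies, as $r=|x|\to1^-$, $$u=d^{-\frac{2}{p-1}}\sum_{k=0}^{[2/(p-1)]}a_k d^k+o(1),$$ where $d=d(r)=1-r$ for $r\in(0,1)$, and where each $a_k\in\mathbb{R}$ depends on $N$ and $p$ only.
   Context: A large solution of $\Delta u=f(u)$ in $B$ is a function $u$ satisfying $\Delta u=f(u)$ in $B$ and $\lim_{x\to x_0,\,x\in B}u(x)=+\infty$ for every $x_0\in\partial B$. $[\cdot]$ denotes the integer part. The positive large solution is unique, hence radial, and is regarded as a function of $r=|x|$. *)

theory Defs
  imports "HOL-Analysis.Analysis" "HOL-Library.Landau_Symbols"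
begin

definition dir_deriv :: "('a::euclidean_space \<Rightarrow> real) \<Rightarrow> 'a \<Rightarrow> 'a \<Rightarrow> real" where
  "dir_deriv u b x = frechet_derivative u (at x) b"

text \<open>The two definitions below are meant for open sets \<open>S\<close>, as they use the full
  neighbourhood filter \<^term>\<open>at x\<close> at each point of \<open>S\<close>. Since \<^const>\<open>frechet_derivative\<close>
  is an arbitrary choice at points of non-differentiability, \<open>laplacian u\<close> is only
  meaningful together with \<open>C2_on S u\<close>.\<close>

definition C2_on :: "'a::euclidean_space set \<Rightarrow> ('a \<Rightarrow> real) \<Rightarrow> bool" where
  "C2_on S u \<longleftrightarrow>
     (\<forall>x\<in>S. u differentiable (at x)) \<and>
     (\<forall>b\<in>Basis. \<forall>x\<in>S. dir_deriv u b differentiable (at x)) \<and>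
     (\<forall>b\<in>Basis. \<forall>c\<in>Basis. continuous_on S (dir_deriv (dir_deriv u b) c))"

definition laplacian :: "('a::euclidean_space \<Rightarrow> real) \<Rightarrow> 'a \<Rightarrow> real" where
  "laplacian u x = (\<Sum>b\<in>Basis. dir_deriv (dir_deriv u b) b x)"

text \<open>Solutions are classical; values of \<open>u\<close> outside the unit ball are irrelevant.\<close>

definition large_solution :: "(real \<Rightarrow> real) \<Rightarrow> ('a::euclidean_space \<Rightarrow> real) \<Rightarrow> bool" where
  "large_solution f u \<longleftrightarrow>
     C2_on (ball 0 1) u \<and>
     (\<forall>x\<in>ball 0 1. laplacian u x = f (u x)) \<and>
     (\<forall>x0\<in>frontier (ball 0 1). filterlim u at_top (at x0 within ball 0 1))"

definition positive_large_solution :: "(real \<Rightarrow> real) \<Rightarrow> ('a::euclidean_space \<Rightarrow> real) \<Rightarrow> bool" where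
  "positive_large_solution f u \<longleftrightarrow> large_solution f u \<and> (\<forall>x\<in>ball 0 1. u x > 0)"

end

theory Submission imports Defs begin

text \<open>
Write \<open>\<alpha> = 2 / (p - 1)\<close>, so that \<open>p \<alpha> = \<alpha> + 2\<close>. The equation \<open>\<Delta>u = u\<^sup>p\<close> is invariant under the
rescaling \<open>u\<^sub>l(x) = l\<^sup>\<alpha> u(l x)\<close>, and this single symmetry, combined with the maximum principle,
carries most of the argument.

\<^emph>\<open>Existence.\<close> The radial initial value problem \<open>u(0) = 1\<close>, \<open>u'(0) = 0\<close> is solved by monotone Picard
iteration on the maximal interval \<open>[0, R)\<close> (\<open>picard_limit\<close>). The explicit supersolution
\<open>c (\<rho>\<^sup>2 - r\<^sup>2) powr (- \<alpha>)\<close> of Keller and Osserman is smaller than 1 at the origin if \<open>\<rho>\<close> is large, so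
the solution cannot live beyond \<open>\<rho>\<close> (\<open>keller_osserman_bound\<close>); hence \<open>R\<close> is finite and \<open>u\<close> blows up
there. Rescaling by \<open>l = R\<close> moves the blow-up to the unit sphere.

\<^emph>\<open>Uniqueness.\<close> For \<open>l > 1\<close> the rescaled radial solution blows up on the smaller sphere of radius
\<open>1 / l\<close>, where any other large solution \<open>v\<close> is still finite, so \<open>v \<le> u\<^sub>l\<close>; for \<open>l < 1\<close> it is finite
on the closed unit ball and \<open>u\<^sub>l \<le> v\<close>. Letting \<open>l\<close> tend to 1 gives \<open>v = u\<close>
(\<open>positive_large_solution_radial\<close>); in particular \<open>v\<close> is radial.

\<^emph>\<open>Formal expansion.\<close> Inserting \<open>d powr (- \<alpha>) * P(d)\<close> into the radial equation leaves the error
\<open>d powr (- \<alpha> - 2)\<close> times a function of \<open>d\<close> (\<open>residual\<close>) that has polynomial approximations of every order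
at 0. Adding \<open>a d\<^sup>m\<close> to \<open>P\<close> changes the coefficient of \<open>d\<^sup>m\<close> in it by
\<open>a ((m - \<alpha>) (m - \<alpha> - 1) - (\<alpha> + 2) (\<alpha> + 1))\<close>, and this factor does not vanish for \<open>1 \<le> m \<le> \<alpha>\<close>. So the
coefficients can be chosen one after the other until the residual is of order \<open>[\<alpha>] + 1\<close>
(\<open>formal_expansion\<close>).

\<^emph>\<open>Barriers.\<close> With \<open>\<gamma> = [\<alpha>] + 1 - \<alpha> \<in> (0, 1]\<close>, the functions \<open>d powr (- \<alpha>) * P(d) \<plusminus> C d powr \<gamma>\<close> are
super- and subsolutions on a layer \<open>0 < d \<le> \<delta>\<close> whose width does not depend on \<open>C\<close>
(\<open>barrier_super\<close>, \<open>barrier_sub\<close>). Hence \<open>C\<close> can be taken so large that they are ordered correctly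
against \<open>u\<close> on the inner edge of the layer. On the outer edge, where both sides are infinite, \<open>u\<close> is
again replaced by \<open>u\<^sub>l\<close> and \<open>l\<close> sent to 1. So \<open>u\<close> differs from \<open>d powr (- \<alpha>) * P(d)\<close> by at most
\<open>C d powr \<gamma>\<close>, which tends to 0 (\<open>large_solution_expansion\<close>).
\<close>

section \<open>Maximum principles\<close>

lemma second_derivative_nonpos_at_local_max:
  fixes f :: "real \<Rightarrow> real"
  assumes "e > 0" and f: "\<And>t. \<bar>t - a\<bar> < e \<Longrightarrow> (f has_real_derivative f' t) (at t)"
    and f': "(f' has_real_derivative D) (at a)"
    and max: "\<And>t. \<bar>t - a\<bar> < e \<Longrightarrow> f t \<le> f a"
  shows "f' a = 0" "D \<le> 0"
proof -
  show 0: "f' a = 0"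
    using DERIV_local_max[OF f[of a] \<open>e > 0\<close>] max \<open>e > 0\<close> by (simp add: abs_minus_commute)
  show "D \<le> 0"
  proof (rule ccontr)
    assume "\<not> D \<le> 0"
    then obtain d where d: "d > 0" "\<And>h. h > 0 \<Longrightarrow> h < d \<Longrightarrow> f' a < f' (a + h)"
      using DERIV_pos_inc_right[OF f'] by auto
    define s where "s = min d e / 2"
    have s: "0 < s" "s < d" "s < e" using d \<open>e > 0\<close> by (auto simp: s_def min_def)
    obtain z where z: "a < z" "z < a + s" "f (a + s) - f a = (a + s - a) * f' z"
      using MVT2[of a "a + s" f f'] f s by auto
    have "f' z > 0" using d(2)[of "z - a"] z s 0 by auto
    hence "f (a + s) > f a" using z(3) s by (simp add: algebra_simps)
    thus False using max[of "a + s"] s by auto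
  qed
qed

text \<open>The superlevel set of \<open>f\<close> through \<open>x0\<close> is compact: \<open>f \<le> 0\<close> near the part of the boundary outside
\<open>S\<close> keeps its limit points inside \<open>S\<close>.\<close>

lemma positive_max_attained:
  fixes f :: "'a::euclidean_space \<Rightarrow> real"
  assumes S: "bounded S" and cont: "continuous_on S f"
    and bd: "\<And>y. y \<in> closure S - S \<Longrightarrow> eventually (\<lambda>x. f x \<le> 0) (at y within S)"
    and x0: "x0 \<in> S" "f x0 > 0"
  shows "\<exists>x\<in>S. f x > 0 \<and> (\<forall>y\<in>S. f y \<le> f x)"
proof -
  define K where "K = {x\<in>S. f x \<ge> f x0}"
  have "closed K"
    unfolding closed_sequential_limits
  proof (intro allI impI, elim conjE)
    fix s l assume s: "\<forall>n. s n \<in> K" and l: "s \<longlonglongrightarrow> l"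
    have sS: "s n \<in> S" "f (s n) \<ge> f x0" for n using s by (auto simp: K_def)
    have "l \<in> closure S" using closure_sequential l sS(1) by blast
    show "l \<in> K"
    proof (cases "l \<in> S")
      case True
      have "(\<lambda>n. f (s n)) \<longlonglongrightarrow> f l"
        using continuous_on_tendsto_compose[OF cont l True] sS by auto
      hence "f l \<ge> f x0" using sS(2) by (meson LIMSEQ_le_const)
      thus ?thesis using True by (auto simp: K_def)
    next
      case False
      have "filterlim s (at l within S) sequentially"
        using l False sS(1) by (auto simp: filterlim_at intro!: always_eventually) 
      hence "eventually (\<lambda>n. f (s n) \<le> 0) sequentially"
        using bd[of l] False \<open>l \<in> closure S\<close> by (auto simp: filterlim_iff)
      then obtain n where "f (s n) \<le> 0" by (auto simp: eventually_sequentially)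
      thus ?thesis using sS(2)[of n] x0 by auto
    qed
  qed
  moreover have "bounded K" using S by (rule bounded_subset) (auto simp: K_def)
  ultimately have "compact K" by (simp add: compact_eq_bounded_closed)
  moreover have "continuous_on K f" using cont by (rule continuous_on_subset) (auto simp: K_def)
  moreover have "K \<noteq> {}" using x0 by (auto simp: K_def)
  ultimately obtain x where x: "x \<in> K" "\<forall>y\<in>K. f y \<le> f x"
    using continuous_attains_sup by blast
  have "f y \<le> f x" if "y \<in> S" for y
    using x that by (cases "f y \<ge> f x0") (auto simp: K_def)
  moreover have "x \<in> S" "f x > 0" using x(1) x0 by (auto simp: K_def)
  ultimately show ?thesis by blast
qed

lemma C2_on_line_derivatives:
  assumes S: "open S" and C2: "C2_on S u" and x: "x \<in> S" and b: "b \<in> Basis"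
  obtains e where "e > 0"
    "\<And>t. \<bar>t\<bar> < e \<Longrightarrow> x + t *\<^sub>R b \<in> S"
    "\<And>t. \<bar>t\<bar> < e \<Longrightarrow> ((\<lambda>t. u (x + t *\<^sub>R b)) has_real_derivative dir_deriv u b (x + t *\<^sub>R b)) (at t)"
    "((\<lambda>t. dir_deriv u b (x + t *\<^sub>R b)) has_real_derivative dir_deriv (dir_deriv u b) b x) (at 0)"
proof -
  obtain e where e: "e > 0" "ball x e \<subseteq> S" using S x open_contains_ball by blast
  have in_S: "x + t *\<^sub>R b \<in> S" if "\<bar>t\<bar> < e" for t
    using e that b by (auto simp: dist_norm subset_iff)
  have line: "((\<lambda>t. w (x + t *\<^sub>R b)) has_real_derivative dir_deriv w b (x + t *\<^sub>R b)) (at t)"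
    if "w differentiable (at (x + t *\<^sub>R b))" for w :: "'a \<Rightarrow> real" and t
  proof -
    have *: "(w has_derivative frechet_derivative w (at (x + t *\<^sub>R b))) (at (x + t *\<^sub>R b))"
      using that frechet_derivative_works by blast
    have "((\<lambda>t. x + t *\<^sub>R b) has_derivative (\<lambda>s. s *\<^sub>R b)) (at t)"
      by (auto intro!: derivative_eq_intros)
    from has_derivative_compose[OF this *]
    have "((\<lambda>t. w (x + t *\<^sub>R b)) has_derivative
            (\<lambda>s. frechet_derivative w (at (x + t *\<^sub>R b)) (s *\<^sub>R b))) (at t)" .
    moreover have "(\<lambda>s. frechet_derivative w (at (x + t *\<^sub>R b)) (s *\<^sub>R b)) =
                   (*) (dir_deriv w b (x + t *\<^sub>R b))"
      using linear_frechet_derivative[OF that] by (auto simp: dir_deriv_def linear_cmul)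
    ultimately show ?thesis by (simp add: has_field_derivative_def)
  qed
  show ?thesis
  proof
    show "((\<lambda>t. dir_deriv u b (x + t *\<^sub>R b)) has_real_derivative dir_deriv (dir_deriv u b) b x) (at 0)"
      using line[of "dir_deriv u b" 0] C2 x b by (auto simp: C2_on_def)
  qed (use e in_S line C2 in \<open>auto simp: C2_on_def\<close>)
qed

lemma C2_on_imp_continuous_on: "C2_on S u \<Longrightarrow> continuous_on S u"
  by (auto simp: C2_on_def intro!: differentiable_imp_continuous_on differentiable_at_imp_differentiable_on)

text \<open>At an interior maximum of \<open>u - v\<close> every pure second derivative of \<open>u - v\<close> is at most 0, by restriction
to coordinate lines.\<close>

lemma laplacian_le_at_max_of_difference:
  assumes S: "open S" and u: "C2_on S u" and v: "C2_on S v" and x: "x \<in> S"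
    and max: "\<And>y. y \<in> S \<Longrightarrow> u y - v y \<le> u x - v x"
  shows "laplacian u x \<le> laplacian v x"
  unfolding laplacian_def
proof (rule sum_mono)
  fix b :: 'a assume b: "b \<in> Basis"
  obtain e1 where e1: "e1 > 0"
    "\<And>t. \<bar>t\<bar> < e1 \<Longrightarrow> x + t *\<^sub>R b \<in> S"
    "\<And>t. \<bar>t\<bar> < e1 \<Longrightarrow> ((\<lambda>t. u (x + t *\<^sub>R b)) has_real_derivative dir_deriv u b (x + t *\<^sub>R b)) (at t)"
    "((\<lambda>t. dir_deriv u b (x + t *\<^sub>R b)) has_real_derivative dir_deriv (dir_deriv u b) b x) (at 0)"
    using C2_on_line_derivatives[OF S u x b] by blast
  obtain e2 where e2: "e2 > 0"
    "\<And>t. \<bar>t\<bar> < e2 \<Longrightarrow> x + t *\<^sub>R b \<in> S"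
    "\<And>t. \<bar>t\<bar> < e2 \<Longrightarrow> ((\<lambda>t. v (x + t *\<^sub>R b)) has_real_derivative dir_deriv v b (x + t *\<^sub>R b)) (at t)"
    "((\<lambda>t. dir_deriv v b (x + t *\<^sub>R b)) has_real_derivative dir_deriv (dir_deriv v b) b x) (at 0)"
    using C2_on_line_derivatives[OF S v x b] by blast
  have "dir_deriv (dir_deriv u b) b x - dir_deriv (dir_deriv v b) b x \<le> 0"
    by (rule second_derivative_nonpos_at_local_max(2)
         [where e = "min e1 e2" and f = "\<lambda>t. u (x + t *\<^sub>R b) - v (x + t *\<^sub>R b)" and a = 0])
       (use e1 e2 max in \<open>auto intro!: DERIV_diff\<close>)
  thus "dir_deriv (dir_deriv u b) b x \<le> dir_deriv (dir_deriv v b) b x" by simp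
qed

text \<open>A positive maximum of \<open>u - v\<close> would contradict the strict inequality between the Laplacians. For
\<open>\<Delta>u = u\<^sup>p\<close> and \<open>\<Delta>v = v\<^sup>p\<close> that inequality holds because the power is strictly increasing.\<close>

lemma comparison_principle:
  assumes S: "open S" "bounded S" and u: "C2_on S u" and v: "C2_on S v"
    and lap: "\<And>x. x \<in> S \<Longrightarrow> u x > v x \<Longrightarrow> laplacian u x > laplacian v x"
    and bd: "\<And>y. y \<in> frontier S \<Longrightarrow> eventually (\<lambda>x. u x \<le> v x) (at y within S)"
    and x: "x \<in> S"
  shows "u x \<le> v x"
proof (rule ccontr)
  assume "\<not> u x \<le> v x"
  moreover have "eventually (\<lambda>x. u x - v x \<le> 0) (at y within S)" if "y \<in> closure S - S" for y
    using bd[of y] that S by (auto simp: frontier_def interior_open)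
  ultimately obtain z where "z \<in> S" "u z > v z" "\<forall>y\<in>S. u y - v y \<le> u z - v z"
    using positive_max_attained[OF S(2), of "\<lambda>x. u x - v x" x] x
      C2_on_imp_continuous_on[OF u] C2_on_imp_continuous_on[OF v]
    by (auto intro: continuous_on_diff)
  thus False
    using laplacian_le_at_max_of_difference[OF S(1) u v, of z] lap[of z] by force
qed

text \<open>The same principle for \<open>u'' + c(r) u'\<close>, the radial Laplacian when \<open>c(r) = (N - 1) / r\<close>. At
a maximum of \<open>u - v\<close> the drift terms of \<open>u\<close> and \<open>v\<close> agree.\<close>

lemma radial_comparison_principle:
  fixes u v :: "real \<Rightarrow> real"
  assumes u: "\<And>r. a < r \<Longrightarrow> r < b \<Longrightarrow> (u has_real_derivative u' r) (at r)"
    "\<And>r. a < r \<Longrightarrow> r < b \<Longrightarrow> (u' has_real_derivative u'' r) (at r)"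
    and v: "\<And>r. a < r \<Longrightarrow> r < b \<Longrightarrow> (v has_real_derivative v' r) (at r)"
    "\<And>r. a < r \<Longrightarrow> r < b \<Longrightarrow> (v' has_real_derivative v'' r) (at r)"
    and op: "\<And>r. a < r \<Longrightarrow> r < b \<Longrightarrow> u r > v r \<Longrightarrow> u'' r + c r * u' r > v'' r + c r * v' r"
    and bd: "eventually (\<lambda>r. u r \<le> v r) (at_right a)" "eventually (\<lambda>r. u r \<le> v r) (at_left b)"
    and r: "a < r" "r < b"
  shows "u r \<le> v r"
proof (rule ccontr)
  assume "\<not> u r \<le> v r"
  have diff: "((\<lambda>x. u x - v x) has_real_derivative u' x - v' x) (at x)"
    "((\<lambda>x. u' x - v' x) has_real_derivative u'' x - v'' x) (at x)" if "a < x" "x < b" for x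
    by (rule DERIV_diff u v that)+
  have "continuous_on {a<..<b} (\<lambda>x. u x - v x)"
    by (rule DERIV_continuous_on[OF has_field_derivative_at_within[OF diff(1)]]) auto
  moreover have "eventually (\<lambda>x. u x - v x \<le> 0) (at y within {a<..<b})"
    if "y \<in> closure {a<..<b} - {a<..<b}" for y
  proof -
    have "y = a \<or> y = b" using that r by auto
    moreover have "at a within {a<..<b} \<le> at_right a" "at b within {a<..<b} \<le> at_left b"
      by (auto intro!: at_le)
    ultimately show ?thesis using bd by (auto intro: filter_leD)
  qed
  ultimately obtain z where z: "z \<in> {a<..<b}" "u z > v z" "\<forall>y\<in>{a<..<b}. u y - v y \<le> u z - v z"
    using positive_max_attained[of "{a<..<b}" "\<lambda>x. u x - v x" r] r \<open>\<not> u r \<le> v r\<close> by auto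
  have *: "a < t" "t < b" if "\<bar>t - z\<bar> < min (z - a) (b - z)" for t
    using that by auto
  have e: "min (z - a) (b - z) > 0" using z by auto
  have le: "u t - v t \<le> u z - v z" if "\<bar>t - z\<bar> < min (z - a) (b - z)" for t
    using z(3) *[OF that] by auto
  have zab: "a < z" "z < b" using z by auto
  have "u' z - v' z = 0"
    by (rule second_derivative_nonpos_at_local_max(1)[OF e _ diff(2)[OF zab], where f = "\<lambda>x. u x - v x"])
       (use diff(1) * le in blast)+
  moreover have "u'' z - v'' z \<le> 0"
    by (rule second_derivative_nonpos_at_local_max(2)[OF e _ diff(2)[OF zab], where f = "\<lambda>x. u x - v x"])
       (use diff(1) * le in blast)+
  ultimately show False using op[OF zab z(2)] by auto
qed

section \<open>Radial functions\<close>

text \<open>The data of a radial function \<open>U(x) = u(|x|)\<close> in dimension \<open>N\<close>: \<open>h = u' / r\<close> and \<open>g = \<Delta>U\<close>, which amounts to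
\<open>r h' = g - N h\<close>. Keeping \<open>h\<close> as a separate function that is continuous up to \<open>r = 0\<close> avoids one-sided second
derivatives at the origin and encodes \<open>u'(0) = 0\<close>.\<close>

definition radial_profile ::
  "nat \<Rightarrow> real \<Rightarrow> (real \<Rightarrow> real) \<Rightarrow> (real \<Rightarrow> real) \<Rightarrow> (real \<Rightarrow> real) \<Rightarrow> bool" where
  "radial_profile N R u h g \<longleftrightarrow>
     continuous_on {0..<R} u \<and> continuous_on {0..<R} h \<and> continuous_on {0..<R} g \<and>
     g 0 = N * h 0 \<and>
     (\<forall>r. 0 < r \<and> r < R \<longrightarrow>
        (u has_real_derivative r * h r) (at r) \<and>
        (h has_real_derivative (g r - N * h r) / r) (at r))"

lemma radial_profile_mean_value:
  assumes "radial_profile N R u h g" "0 < r" "r < R"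
  obtains s where "0 < s" "s < r" "u r - u 0 = r * (s * h s)"
proof -
  have "continuous_on {0..r} u" using assms unfolding radial_profile_def
    by (auto elim: continuous_on_subset)
  moreover have "(u has_derivative (*) (x * h x)) (at x)" if "0 < x" "x < r" for x
    using assms that by (auto simp: radial_profile_def has_field_derivative_def)
  ultimately obtain z where "0 < z" "z < r" "u r - u 0 = (z * h z) * (r - 0)"
    using mvt[of 0 r u "\<lambda>x. (*) (x * h x)"] assms(2) by blast
  thus ?thesis using that by (simp add: mult_ac)
qed

text \<open>Off the origin this is the chain rule. At the origin \<open>u' = r h\<close> with bounded \<open>h\<close> makes
\<open>u(|x|) - u(0)\<close> quadratically small, so the gradient vanishes there.\<close>

lemma radial_profile_has_derivative:
  fixes x :: "'a::euclidean_space"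
  assumes R: "radial_profile N R u h g" and x: "norm x < R"
  shows "((\<lambda>x::'a. u (norm x)) has_derivative (\<lambda>v. (x \<bullet> v) * h (norm x))) (at x)"
proof (cases "x = 0")
  case False
  hence "(u has_derivative (*) (norm x * h (norm x))) (at (norm x))"
    using R x by (auto simp: radial_profile_def has_field_derivative_def)
  from has_derivative_compose[OF has_derivative_norm[OF False] this]
  show ?thesis by (rule has_derivative_eq_rhs)
    (use False in \<open>auto simp: fun_eq_iff sgn_div_norm inner_commute\<close>)
next
  case True
  hence "R > 0" using x by auto
  have "continuous_on {0..R/2} h" using R \<open>R > 0\<close> unfolding radial_profile_def
    by (auto elim: continuous_on_subset)
  hence "bounded (h ` {0..R/2})" by (intro compact_imp_bounded compact_continuous_image) auto
  then obtain M where M: "M > 0" "\<And>r. 0 \<le> r \<Longrightarrow> r \<le> R/2 \<Longrightarrow> \<bar>h r\<bar> \<le> M"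
    unfolding bounded_pos by (auto simp: Ball_def)
  have bd: "\<bar>u (norm y) - u 0\<bar> \<le> M * (norm y)\<^sup>2" if "norm y \<le> R/2" for y :: 'a
  proof (cases "y = 0")
    case False
    hence "0 < norm y" "norm y < R" using that \<open>R > 0\<close> by auto
    then obtain s where s: "0 < s" "s < norm y" "u (norm y) - u 0 = norm y * (s * h s)"
      using radial_profile_mean_value[OF R] by blast
    have "\<bar>s * h s\<bar> \<le> norm y * M"
      unfolding abs_mult using s M(2)[of s] that by (intro mult_mono) auto
    hence "norm y * \<bar>s * h s\<bar> \<le> norm y * (norm y * M)" by (intro mult_left_mono) auto
    thus ?thesis unfolding s(3) by (simp add: abs_mult power2_eq_square mult_ac)
  qed auto
  have "((\<lambda>y::'a. \<bar>u (norm y) - u 0\<bar> / norm y) \<longlongrightarrow> 0) (at 0)"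
  proof (rule tendsto_sandwich[where f = "\<lambda>_. 0" and h = "\<lambda>y. M * norm y"])
    show "eventually (\<lambda>y::'a. \<bar>u (norm y) - u 0\<bar> / norm y \<le> M * norm y) (at 0)"
      unfolding eventually_at
    proof (intro exI[of _ "R/2"] conjI ballI impI)
      fix y :: 'a assume "y \<noteq> 0 \<and> dist y 0 < R/2"
      thus "\<bar>u (norm y) - u 0\<bar> / norm y \<le> M * norm y"
        using bd[of y] by (simp add: divide_le_eq power2_eq_square mult_ac)
    qed (use \<open>R > 0\<close> in auto)
    show "((\<lambda>y::'a. M * norm y) \<longlongrightarrow> 0) (at 0)"
      by (auto intro!: tendsto_eq_intros)
  qed auto
  thus ?thesis unfolding has_derivative_iff_norm True by simp
qed

text \<open>At the origin the last summand is 0 by the convention \<open>t / 0 = 0\<close>, and the formula there says that the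
Hessian is \<open>h(0)\<close> times the identity.\<close>

lemma radial_profile_has_second_derivative:
  fixes x b :: "'a::euclidean_space"
  assumes R: "radial_profile N R u h g" and x: "norm x < R"
  shows "((\<lambda>x. (x \<bullet> b) * h (norm x)) has_derivative
     (\<lambda>v. (v \<bullet> b) * h (norm x) + (x \<bullet> b) * (x \<bullet> v) * (g (norm x) - N * h (norm x)) / (norm x)\<^sup>2)) (at x)"
proof (cases "x = 0")
  case False
  hence "(h has_derivative (*) ((g (norm x) - N * h (norm x)) / norm x)) (at (norm x))"
    using R x by (auto simp: radial_profile_def has_field_derivative_def)
  from has_derivative_compose[OF has_derivative_norm[OF False] this]
  have "((\<lambda>x. h (norm x)) has_derivative
        (\<lambda>v. (g (norm x) - N * h (norm x)) / norm x * (v \<bullet> sgn x))) (at x)"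
    by (simp add: inner_commute)
  moreover have "((\<lambda>x. x \<bullet> b) has_derivative (\<lambda>v. v \<bullet> b)) (at x)"
    by (auto intro!: derivative_eq_intros)
  ultimately have "((\<lambda>x. (x \<bullet> b) * h (norm x)) has_derivative
     (\<lambda>v. (x \<bullet> b) * ((g (norm x) - N * h (norm x)) / norm x * (v \<bullet> sgn x)) + (v \<bullet> b) * h (norm x))) (at x)"
    using has_derivative_mult by blast
  thus ?thesis by (rule has_derivative_eq_rhs)
    (use False in \<open>auto simp: fun_eq_iff sgn_div_norm inner_commute power2_eq_square field_simps\<close>)
next
  case True
  hence "R > 0" using x by auto
  have "(h \<longlongrightarrow> h 0) (at 0 within {0..<R})"
    using R \<open>R > 0\<close> by (auto simp: radial_profile_def continuous_on_def)
  moreover have "filterlim norm (at 0 within {0..<R}) (at (0::'a))"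
    unfolding filterlim_at using \<open>R > 0\<close>
    by (auto intro!: tendsto_eq_intros simp: eventually_at intro: exI[of _ R])
  ultimately have "((\<lambda>y::'a. h (norm y)) \<longlongrightarrow> h 0) (at 0)"
    by (rule filterlim_compose)
  hence lim: "((\<lambda>y::'a. norm b * \<bar>h (norm y) - h 0\<bar>) \<longlongrightarrow> 0) (at 0)"
    by (auto intro!: tendsto_eq_intros)
  have "((\<lambda>y::'a. norm ((y \<bullet> b) * h (norm y) - (y \<bullet> b) * h 0) / norm y) \<longlongrightarrow> 0) (at 0)"
  proof (rule tendsto_sandwich[OF _ _ _ lim, where f = "\<lambda>_. 0"])
    show "eventually (\<lambda>y::'a. norm ((y \<bullet> b) * h (norm y) - (y \<bullet> b) * h 0) / norm y
                         \<le> norm b * \<bar>h (norm y) - h 0\<bar>) (at 0)"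
    proof (intro always_eventually allI)
      fix y :: 'a
      have "\<bar>y \<bullet> b\<bar> * \<bar>h (norm y) - h 0\<bar> \<le> (norm y * norm b) * \<bar>h (norm y) - h 0\<bar>"
        by (intro mult_right_mono Cauchy_Schwarz_ineq2) auto
      hence "norm ((y \<bullet> b) * h (norm y) - (y \<bullet> b) * h 0) \<le> norm b * \<bar>h (norm y) - h 0\<bar> * norm y"
        unfolding right_diff_distrib[symmetric] real_norm_def abs_mult by (simp add: mult_ac)
      thus "norm ((y \<bullet> b) * h (norm y) - (y \<bullet> b) * h 0) / norm y \<le> norm b * \<bar>h (norm y) - h 0\<bar>"
        by (cases "y = 0") (simp_all add: divide_le_eq)
    qed
  qed auto
  moreover have "bounded_linear (\<lambda>v::'a. (v \<bullet> b) * h 0)"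
    by (intro bounded_linear_intros)
  ultimately show ?thesis unfolding has_derivative_iff_norm True by simp
qed

lemma continuous_on_radial:
  assumes "continuous_on {0..<R} f"
  shows "continuous_on (ball (0::'a::real_normed_vector) R) (\<lambda>x. f (norm x))"
  by (rule continuous_on_compose2[OF assms]) (auto intro!: continuous_intros)

text \<open>The factor \<open>(x \<bullet> b) (x \<bullet> c) / |x|\<^sup>2\<close> is bounded but discontinuous at the origin; it is compensated by
\<open>g - N h\<close>, which vanishes there.\<close>

lemma continuous_on_radial_hessian:
  fixes b c :: "'a::euclidean_space"
  assumes R: "radial_profile N R u h g"
  shows "continuous_on (ball 0 R)
           (\<lambda>x::'a. (x \<bullet> b) * (x \<bullet> c) * (g (norm x) - N * h (norm x)) / (norm x)\<^sup>2)"
proof -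
  define w where "w = (\<lambda>x::'a. g (norm x) - N * h (norm x))"
  define q where "q = (\<lambda>x::'a. (x \<bullet> b) * (x \<bullet> c) * w x / (norm x)\<^sup>2)"
  have w: "continuous_on (ball 0 R) w" unfolding w_def using R
    by (intro continuous_intros continuous_on_radial) (auto simp: radial_profile_def)
  have w0: "w 0 = 0" using R by (simp add: w_def radial_profile_def)
  have "isCont q x" if x: "x \<in> ball 0 R" for x
  proof (cases "x = 0")
    case False
    have "isCont w x" using w x by (simp add: continuous_on_eq_continuous_at)
    thus ?thesis unfolding q_def using False by (intro continuous_intros) auto
  next
    case True
    have "(w \<longlongrightarrow> w 0) (at 0)"
      using w x True by (simp add: continuous_on_eq_continuous_at isCont_def)
    hence lim: "((\<lambda>x. norm b * norm c * \<bar>w x\<bar>) \<longlongrightarrow> 0) (at 0)"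
      using w0 by (auto intro!: tendsto_eq_intros)
    have "(q \<longlongrightarrow> 0) (at 0)"
    proof (rule Lim_null_comparison[OF always_eventually lim], rule allI)
      fix y :: 'a
      have "\<bar>y \<bullet> b\<bar> * \<bar>y \<bullet> c\<bar> \<le> (norm y * norm b) * (norm y * norm c)"
        by (intro mult_mono Cauchy_Schwarz_ineq2) auto
      hence "\<bar>y \<bullet> b\<bar> * \<bar>y \<bullet> c\<bar> * \<bar>w y\<bar> \<le> (norm y * norm b) * (norm y * norm c) * \<bar>w y\<bar>"
        by (intro mult_right_mono) auto
      thus "norm (q y) \<le> norm b * norm c * \<bar>w y\<bar>"
        by (cases "y = 0") (auto simp: q_def abs_mult divide_le_eq power2_eq_square mult_ac)
    qed
    thus ?thesis unfolding True isCont_def by (simp add: q_def)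
  qed
  thus ?thesis unfolding q_def w_def by (simp add: continuous_at_imp_continuous_on)
qed

text \<open>The diagonal of the Hessian sums to \<open>N h + (g - N h) = g\<close>.\<close>

proposition radial_profile_C2_laplacian:
  assumes R: "radial_profile DIM('a) R u h g"
  shows "C2_on (ball 0 R) (\<lambda>x::'a::euclidean_space. u (norm x))" (is "C2_on _ ?U")
    and "\<And>x::'a. norm x < R \<Longrightarrow> laplacian (\<lambda>x. u (norm x)) x = g (norm x)"
proof -
  let ?N = "real DIM('a)"
  have d1: "(?U has_derivative (\<lambda>v. (x \<bullet> v) * h (norm x))) (at x)" if "norm x < R" for x :: 'a
    using radial_profile_has_derivative[OF R that] .
  have dd1: "dir_deriv ?U b x = (x \<bullet> b) * h (norm x)" if "norm x < R" for b x :: 'a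
    using frechet_derivative_at[OF d1[OF that], symmetric] by (simp add: dir_deriv_def)
  have d2: "(dir_deriv ?U b has_derivative
     (\<lambda>v. (v \<bullet> b) * h (norm x) + (x \<bullet> b) * (x \<bullet> v) * (g (norm x) - ?N * h (norm x)) / (norm x)\<^sup>2)) (at x)"
    if "norm x < R" for x b :: 'a
    by (rule has_derivative_transform_within_open[OF radial_profile_has_second_derivative[OF R that],
          of "ball 0 R"]) (use that dd1 in auto)
  have dd2: "dir_deriv (dir_deriv ?U b) c x =
     (c \<bullet> b) * h (norm x) + (x \<bullet> b) * (x \<bullet> c) * (g (norm x) - ?N * h (norm x)) / (norm x)\<^sup>2"
    if "norm x < R" for x b c :: 'a
    using frechet_derivative_at[OF d2[OF that], symmetric] by (simp add: dir_deriv_def)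
  have cont: "continuous_on (ball 0 R) (dir_deriv (dir_deriv ?U b) c)" for b c :: 'a
  proof -
    have "continuous_on (ball 0 R) (\<lambda>x. (c \<bullet> b) * h (norm x) +
            (x \<bullet> b) * (x \<bullet> c) * (g (norm x) - ?N * h (norm x)) / (norm x)\<^sup>2)"
      using R by (intro continuous_on_add continuous_on_radial_hessian[OF R] continuous_intros
                        continuous_on_radial) (auto simp: radial_profile_def)
    thus ?thesis by (rule continuous_on_cong[THEN iffD1, rotated -1]) (auto simp: dd2)
  qed
  show "C2_on (ball 0 R) ?U"
    unfolding C2_on_def using d1 d2 cont by (auto simp: differentiable_def; blast)
  fix x :: 'a assume x: "norm x < R"
  have "(\<Sum>b\<in>Basis. (x \<bullet> b) * (x \<bullet> b)) = (norm x)\<^sup>2"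
    by (simp add: euclidean_inner[symmetric] power2_norm_eq_inner)
  moreover have "laplacian ?U x = (\<Sum>b\<in>Basis. h (norm x) + (x \<bullet> b) * (x \<bullet> b) * ((g (norm x) - ?N * h (norm x)) / (norm x)\<^sup>2))"
    unfolding laplacian_def using x by (intro sum.cong) (auto simp: dd2)
  ultimately have *: "laplacian ?U x = ?N * h (norm x) + (norm x)\<^sup>2 * ((g (norm x) - ?N * h (norm x)) / (norm x)\<^sup>2)"
    by (simp only: sum.distrib sum_distrib_right[symmetric] sum_constant)
  show "laplacian ?U x = g (norm x)"
  proof (cases "x = 0")
    case True
    thus ?thesis using * R by (simp add: radial_profile_def)
  qed (use * in simp)
qed

section \<open>The radial initial value problem\<close>

text \<open>The derivative at \<open>t\<close> of the radial solution of \<open>\<Delta>u = g\<close>, by the divergence theorem. Its value at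
\<open>t = 0\<close> is 0 for every \<open>N\<close>, because the integral vanishes.\<close>

definition flux :: "nat \<Rightarrow> (real \<Rightarrow> real) \<Rightarrow> real \<Rightarrow> real" where
  "flux N g t = integral {0..t} (\<lambda>s. s ^ (N - 1) * g s) / t ^ (N - 1)"

lemma integral_monomial:
  assumes "N > 0" "t \<ge> (0::real)"
  shows "((\<lambda>s. s ^ (N - 1)) has_integral t ^ N / N) {0..t}"
proof -
  have "((\<lambda>s. s ^ (N - 1)) has_integral (t ^ N / N - 0 ^ N / N)) {0..t}"
    using assms by (intro fundamental_theorem_of_calculus)
      (auto intro!: derivative_eq_intros simp flip: has_real_derivative_iff_has_vector_derivative)
  thus ?thesis using assms by (simp add: zero_power)
qed

context
  fixes N :: nat and b :: real and g :: "real \<Rightarrow> real"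
  assumes N: "N > 0" and cont: "continuous_on {0..<b} g" and mono: "mono_on {0..<b} g"
    and nonneg: "\<And>r. 0 \<le> r \<Longrightarrow> r < b \<Longrightarrow> 0 \<le> g r"
begin

lemma flux_integrand_continuous: "t < b \<Longrightarrow> continuous_on {0..t} (\<lambda>s. s ^ (N - 1) * g s)"
  by (intro continuous_intros continuous_on_subset[OF cont]) auto

text \<open>Monotonicity of \<open>g\<close> confines the average of \<open>g\<close> over the ball of radius \<open>t\<close> to \<open>[g(0), g(t)]\<close>. These
two bounds give continuity of \<open>u' / r\<close> at the centre.\<close>

lemma flux_bounds:
  assumes t: "0 \<le> t" "t < b"
  shows "t * g 0 / N \<le> flux N g t" "flux N g t \<le> t * g t / N"
proof -
  have I: "(\<lambda>s. s ^ (N - 1) * g s) integrable_on {0..t}"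
    using flux_integrand_continuous[OF t(2)] by (rule integrable_continuous_real)
  have m: "g x \<le> g y" if "0 \<le> x" "x \<le> y" "y \<le> t" for x y
    using mono_onD[OF mono, of x y] that t by auto
  have P: "t ^ N = t ^ (N - 1) * t"
    using N by (cases N) auto
  have "t ^ N / N * g 0 \<le> integral {0..t} (\<lambda>s. s ^ (N - 1) * g s)"
    by (rule has_integral_le[OF has_integral_mult_left[OF integral_monomial[OF N t(1)]] integrable_integral[OF I]])
       (auto intro!: mult_left_mono m)
  thus "t * g 0 / N \<le> flux N g t"
    using t by (cases "t = 0") (auto simp: flux_def le_divide_eq P mult_ac)
  have "integral {0..t} (\<lambda>s. s ^ (N - 1) * g s) \<le> t ^ N / N * g t"
    by (rule has_integral_le[OF integrable_integral[OF I] has_integral_mult_left[OF integral_monomial[OF N t(1)]]])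
       (auto intro!: mult_left_mono m)
  thus "flux N g t \<le> t * g t / N"
    using t by (cases "t = 0") (auto simp: flux_def divide_le_eq P mult_ac)
qed

lemma flux_nonneg: "0 \<le> t \<Longrightarrow> t < b \<Longrightarrow> 0 \<le> flux N g t"
  using flux_bounds(1)[of t] nonneg[of 0] by (smt (verit) divide_nonneg_nonneg mult_nonneg_nonneg of_nat_0_le_iff)

lemma flux_le: assumes "0 \<le> t" "t < b" shows "flux N g t \<le> t * g t"
proof -
  have "t * g t / N \<le> t * g t / 1"
    using N assms nonneg[of t] by (intro divide_left_mono mult_nonneg_nonneg) auto
  thus ?thesis using flux_bounds(2)[OF assms] by simp
qed

lemma flux_quotient_derivative:
  assumes t: "0 < t" "t < b"
  shows "((\<lambda>r. if r = 0 then g 0 / N else flux N g r / r) has_real_derivative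
           (g t - N * (flux N g t / t)) / t) (at t)"
proof -
  define G where "G = (\<lambda>t. integral {0..t} (\<lambda>s. s ^ (N - 1) * g s))"
  obtain c where c: "t < c" "c < b" using dense t by blast
  have "(G has_real_derivative t ^ (N - 1) * g t) (at t within {0..c})"
    unfolding G_def using flux_integrand_continuous[OF c(2)] t c
    by (intro integral_has_real_derivative) auto
  hence G: "(G has_real_derivative t ^ (N - 1) * g t) (at t)"
    using t c by (simp add: at_within_Icc_at)
  have P: "t ^ N = t ^ (N - 1) * t" using N by (cases N) auto
  have F: "flux N g t = G t / t ^ (N - 1)" by (simp add: flux_def G_def)
  have "((\<lambda>r. G r / r ^ N) has_real_derivative
          (t ^ (N - 1) * g t * t ^ N - G t * (N * t ^ (N - 1))) / (t ^ N * t ^ N)) (at t)"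
    using t by (auto intro!: derivative_eq_intros G simp: power_add)
  also have "(t ^ (N - 1) * g t * t ^ N - G t * (N * t ^ (N - 1))) / (t ^ N * t ^ N) =
       (g t - N * (flux N g t / t)) / t"
    using t N unfolding F P by (simp add: field_simps)
  finally show ?thesis
  proof (rule has_field_derivative_transform_within_open[where S = "{0<..}"])
    fix r :: real assume "r \<in> {0<..}"
    moreover have "r ^ N = r ^ (N - 1) * r" using N by (cases N) auto
    ultimately show "G r / r ^ N = (if r = 0 then g 0 / N else flux N g r / r)"
      by (simp add: flux_def G_def)
  qed (use t in auto)
qed

lemma flux_quotient_continuous:
  "continuous_on {0..<b} (\<lambda>r. if r = 0 then g 0 / N else flux N g r / r)" (is "continuous_on _ ?h")
  unfolding continuous_on_def
proof
  fix t assume t: "t \<in> {0..<b}"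
  show "(?h \<longlongrightarrow> ?h t) (at t within {0..<b})"
  proof (cases "t = 0")
    case False
    hence "isCont ?h t" using flux_quotient_derivative[of t] t DERIV_isCont by fastforce
    thus ?thesis unfolding isCont_def by (rule tendsto_within_subset) auto
  next
    case True
    have lim: "((\<lambda>r. g r / N) \<longlongrightarrow> g 0 / N) (at 0 within {0..<b})"
      using cont t True N by (auto simp: continuous_on_def intro!: tendsto_intros)
    have "(?h \<longlongrightarrow> g 0 / N) (at 0 within {0..<b})"
    proof (rule tendsto_sandwich[OF _ _ tendsto_const lim])
      show "eventually (\<lambda>r. g 0 / N \<le> ?h r) (at 0 within {0..<b})"
        using flux_bounds(1) by (auto simp: eventually_at_topological le_divide_eq mult_ac intro!: exI[of _ UNIV])
      show "eventually (\<lambda>r. ?h r \<le> g r / N) (at 0 within {0..<b})"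
        using flux_bounds(2) by (auto simp: eventually_at_topological divide_le_eq mult_ac intro!: exI[of _ UNIV])
    qed
    thus ?thesis using True by simp
  qed
qed

lemma flux_continuous: "continuous_on {0..<b} (flux N g)"
proof -
  have "flux N g 0 = 0" by (simp add: flux_def)
  hence "flux N g r = r * (if r = 0 then g 0 / N else flux N g r / r)" for r by simp
  thus ?thesis using continuous_on_mult[OF continuous_on_id flux_quotient_continuous] by simp
qed

text \<open>Two radial integrations solve \<open>\<Delta>u = g\<close> with \<open>u(0) = 1\<close>.\<close>

lemma radial_poisson:
  "radial_profile N b (\<lambda>r. 1 + integral {0..r} (flux N g))
     (\<lambda>r. if r = 0 then g 0 / N else flux N g r / r) g"
proof -
  have fc: "continuous_on {0..c} (flux N g)" if "c < b" for c
    using flux_continuous by (rule continuous_on_subset) (use that in auto)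
  have u: "((\<lambda>r. 1 + integral {0..r} (flux N g)) has_real_derivative flux N g t) (at t within {0..c})"
    if t: "0 \<le> t" "t \<le> c" "c < b" for t c
    using integral_has_real_derivative[OF fc[OF t(3)], of t] t by (auto intro!: derivative_eq_intros)
  have "continuous_on {0..<b} (\<lambda>r. 1 + integral {0..r} (flux N g))"
    unfolding continuous_on_def
  proof
    fix t assume t: "t \<in> {0..<b}"
    then obtain c where c: "t < c" "c < b" using dense[of t b] by auto
    have "continuous (at t within {0..c}) (\<lambda>r. 1 + integral {0..r} (flux N g))"
      using u[of t c] t c by (intro DERIV_continuous) auto
    moreover have "at t within {0..<b} = at t within {0..c}"
      by (rule at_within_nhd[of _ "{..<c}"]) (use t c in auto)
    ultimately show "((\<lambda>r. 1 + integral {0..r} (flux N g)) \<longlongrightarrow> 1 + integral {0..t} (flux N g)) (at t within {0..<b})"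
      by (simp add: continuous_within)
  qed
  moreover have "((\<lambda>r. 1 + integral {0..r} (flux N g)) has_real_derivative flux N g t) (at t)"
    if t: "0 < t" "t < b" for t
  proof -
    obtain c where c: "t < c" "c < b" using dense t by blast
    show ?thesis using u[of t c] t c by (simp add: at_within_Icc_at)
  qed
  ultimately show ?thesis
    unfolding radial_profile_def
    using flux_quotient_continuous flux_quotient_derivative cont N by (auto split: if_splits)
qed

text \<open>The second bound limits how fast a Picard iterate can grow in terms of the previous iterate.\<close>

lemma poisson_increment:
  assumes "0 \<le> r" "r \<le> t" "t < b"
  shows "integral {0..r} (flux N g) \<le> integral {0..t} (flux N g)"
    and "integral {0..t} (flux N g) \<le> integral {0..r} (flux N g) + (t - r) * (t * g t)"
proof -
  have fc: "continuous_on {c..t} (flux N g)" if "0 \<le> c" for c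
    using flux_continuous by (rule continuous_on_subset) (use assms that in auto)
  have eq: "integral {0..r} (flux N g) + integral {r..t} (flux N g) = integral {0..t} (flux N g)"
    using assms fc by (intro Henstock_Kurzweil_Integration.integral_combine integrable_continuous_real) auto
  have "0 \<le> integral {r..t} (flux N g)"
    using assms fc flux_nonneg by (intro integral_nonneg integrable_continuous_real) auto
  thus "integral {0..r} (flux N g) \<le> integral {0..t} (flux N g)" using eq by simp
  have "flux N g x \<le> t * g t" if "x \<in> {r..t}" for x
  proof -
    have "flux N g x \<le> x * g x" using flux_le that assms by auto
    also have "\<dots> \<le> t * g t"
      using that assms mono_onD[OF mono, of x t] nonneg[of x] by (intro mult_mono) auto
    finally show ?thesis .
  qed
  hence "integral {r..t} (flux N g) \<le> integral {r..t} (\<lambda>_. t * g t)"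
    using assms fc by (intro integral_le integrable_continuous_real) auto
  also have "\<dots> = (t - r) * (t * g t)" using assms by simp
  finally show "integral {0..t} (flux N g) \<le> integral {0..r} (flux N g) + (t - r) * (t * g t)"
    using eq by linarith
qed

end

primrec picard :: "nat \<Rightarrow> real \<Rightarrow> nat \<Rightarrow> real \<Rightarrow> real" where
  "picard N p 0 = (\<lambda>r. 1)"
| "picard N p (Suc n) = (\<lambda>r. 1 + integral {0..r} (flux N (\<lambda>s. picard N p n s powr p)))"

context
  fixes N :: nat and p :: real
  assumes N: "N > 0" and p: "p > 1"
begin

lemma powr_source:
  assumes "continuous_on {0..<b} u" "mono_on {0..<b} u" "\<And>r. 0 \<le> r \<Longrightarrow> r < b \<Longrightarrow> u r \<ge> 1"
  shows "continuous_on {0..<b} (\<lambda>r. u r powr p)" "mono_on {0..<b} (\<lambda>r. u r powr p)"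
    "\<And>r. 0 \<le> r \<Longrightarrow> r < b \<Longrightarrow> 0 \<le> u r powr p"
proof -
  show "continuous_on {0..<b} (\<lambda>r. u r powr p)"
  proof (intro continuous_intros assms ballI)
    fix r assume "r \<in> {0..<b}"
    thus "u r \<noteq> 0" using assms(3)[of r] by auto
  qed
  show "mono_on {0..<b} (\<lambda>r. u r powr p)"
  proof (rule mono_onI)
    fix r s assume "r \<in> {0..<b}" "s \<in> {0..<b}" "r \<le> s"
    thus "u r powr p \<le> u s powr p"
      using mono_onD[OF assms(2), of r s] assms(3)[of r] p by (intro powr_mono2) auto
  qed
qed simp

lemma picard_regular:
  "continuous_on {0..<b} (picard N p n) \<and> mono_on {0..<b} (picard N p n) \<and>
   (\<forall>r. 0 \<le> r \<longrightarrow> r < b \<longrightarrow> picard N p n r \<ge> 1)"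
proof (induction n)
  case (Suc n)
  note S = powr_source[of b "picard N p n"]
  have "radial_profile N b (picard N p (Suc n)) (\<lambda>r. if r = 0 then (picard N p n 0 powr p) / N
          else flux N (\<lambda>s. picard N p n s powr p) r / r) (\<lambda>s. picard N p n s powr p)"
    using radial_poisson[OF N S] Suc by simp
  moreover have "mono_on {0..<b} (picard N p (Suc n))"
    using poisson_increment(1)[OF N S] Suc by (auto intro!: mono_onI)
  moreover have "picard N p (Suc n) r \<ge> 1" if "0 \<le> r" "r < b" for r
    using poisson_increment(1)[OF N S, of 0 r] Suc that by simp
  ultimately show ?case by (auto simp: radial_profile_def)
qed (auto intro!: mono_onI)

lemma picard_mono: "0 \<le> r \<Longrightarrow> r \<le> s \<Longrightarrow> picard N p n r \<le> picard N p n s"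
  and picard_ge_1: "0 \<le> r \<Longrightarrow> 1 \<le> picard N p n r"
  using picard_regular[of "s + 1" n] picard_regular[of "r + 1" n]
  by (auto intro: mono_onD)

lemma picard_source:
  "continuous_on {0..<b} (\<lambda>r. picard N p n r powr p)" "mono_on {0..<b} (\<lambda>r. picard N p n r powr p)"
  "\<And>r. 0 \<le> r \<Longrightarrow> r < b \<Longrightarrow> 0 \<le> picard N p n r powr p"
  using powr_source[of b "picard N p n"] picard_regular[of b n] by auto

lemma picard_flux_continuous: "0 \<le> c \<Longrightarrow> continuous_on {c..t} (flux N (\<lambda>s. picard N p n s powr p))"
  by (rule continuous_on_subset[OF flux_continuous[OF N picard_source[where b = "t + 1"]]]) auto

lemma picard_incseq: "0 \<le> r \<Longrightarrow> picard N p n r \<le> picard N p (Suc n) r"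
proof (induction n arbitrary: r)
  case 0
  show ?case using picard_ge_1[OF 0, of "Suc 0"] by simp
next
  case (Suc n)
  have "flux N (\<lambda>s. picard N p n s powr p) t \<le> flux N (\<lambda>s. picard N p (Suc n) s powr p) t"
    if t: "0 \<le> t" for t
  proof -
    have I: "(\<lambda>s. s ^ (N - 1) * picard N p k s powr p) integrable_on {0..t}" for k
      using flux_integrand_continuous[OF N picard_source[where b = "t + 1"], of t]
      by (intro integrable_continuous_real) auto
    have "picard N p n s powr p \<le> picard N p (Suc n) s powr p" if "0 \<le> s" for s
      using Suc.IH[OF that] picard_ge_1[OF that, of n] p by (intro powr_mono2) auto
    hence "integral {0..t} (\<lambda>s. s ^ (N - 1) * picard N p n s powr p) \<le>
           integral {0..t} (\<lambda>s. s ^ (N - 1) * picard N p (Suc n) s powr p)"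
      by (intro integral_le I mult_left_mono) auto
    thus ?thesis unfolding flux_def using t by (intro divide_right_mono) auto
  qed
  hence "integral {0..r} (flux N (\<lambda>s. picard N p n s powr p)) \<le>
         integral {0..r} (flux N (\<lambda>s. picard N p (Suc n) s powr p))"
    by (intro integral_le integrable_continuous_real picard_flux_continuous) auto
  thus ?case by simp
qed

text \<open>A bound \<open>M\<close> that holds for all iterates at \<open>r\<close> survives, with \<open>2 M\<close> instead of \<open>M\<close>, a step \<open>d\<close> to the
right whose size depends only on \<open>M\<close> and \<open>r\<close>. This replaces the usual local existence theorem in the
argument that a solution which stays bounded can be continued.\<close>

lemma picard_extension:
  assumes r: "0 \<le> r" and d: "0 \<le> d" "d * ((r + d) * (2 * M) powr p) \<le> M"
    and M: "\<And>n. picard N p n r \<le> M"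
  shows "picard N p n (r + d) \<le> 2 * M"
proof (induction n)
  case 0
  show ?case using M[of 0] by simp
next
  case (Suc n)
  have "picard N p (Suc n) (r + d) \<le> picard N p (Suc n) r + d * ((r + d) * picard N p n (r + d) powr p)"
    using poisson_increment(2)[OF N picard_source[where b = "r + d + 1"], of r "r + d"] r d by simp
  also have "\<dots> \<le> M + d * ((r + d) * (2 * M) powr p)"
    using Suc M[of "Suc n"] r d p picard_ge_1[of "r + d" n]
    by (intro add_mono mult_left_mono powr_mono2) auto
  also have "\<dots> \<le> 2 * M" using d by simp
  finally show ?case .
qed

text \<open>Wherever the increasing iterates stay bounded they converge. Dominated convergence, applied to both
integrations, shows that the limit satisfies the integral equation, which in turn makes the limit
continuous and hence twice differentiable.\<close>

lemma picard_limit: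
  assumes bd: "\<And>r. 0 \<le> r \<Longrightarrow> r < b \<Longrightarrow> \<exists>M. \<forall>n. picard N p n r \<le> M"
  obtains u h g where "radial_profile N b u h g"
    "\<And>r. 0 \<le> r \<Longrightarrow> r < b \<Longrightarrow> g r = u r powr p"
    "\<And>r. 0 \<le> r \<Longrightarrow> r < b \<Longrightarrow> 1 \<le> u r"
    "mono_on {0..<b} u"
    "\<And>r n. 0 \<le> r \<Longrightarrow> r < b \<Longrightarrow> picard N p n r \<le> u r"
    "u 0 = 1"
proof -
  define u where "u r = (SUP n. picard N p n r)" for r
  have inc: "incseq (\<lambda>n. picard N p n r)" if "0 \<le> r" for r
    using picard_incseq[OF that] by (rule incseq_SucI)
  have ba: "bdd_above (range (\<lambda>n. picard N p n r))" if "0 \<le> r" "r < b" for r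
    using bd[OF that] by (auto simp: bdd_above_def)
  have lim: "(\<lambda>n. picard N p n r) \<longlonglongrightarrow> u r" if "0 \<le> r" "r < b" for r
    unfolding u_def using LIMSEQ_incseq_SUP[OF ba inc] that by auto
  have le: "picard N p n r \<le> u r" if "0 \<le> r" "r < b" for r n
    unfolding u_def using ba[OF that] by (auto intro: cSUP_upper)
  have ge1: "u r \<ge> 1" if "0 \<le> r" "r < b" for r using le[OF that, of 0] by simp
  have mono: "u r \<le> u s" if "0 \<le> r" "r \<le> s" "s < b" for r s
    by (rule LIMSEQ_le[OF lim lim]) (use that picard_mono in auto)
  have plim: "(\<lambda>n. picard N p n r powr p) \<longlonglongrightarrow> u r powr p" if "0 \<le> r" "r < b" for r
    using lim[OF that] ge1[OF that] by (intro tendsto_intros) auto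
  have ple: "picard N p n s powr p \<le> u t powr p" if "0 \<le> s" "s \<le> t" "t < b" for n s t
    using le[of s n] mono[of s t] picard_ge_1[of s n] p that by (intro powr_mono2) auto
  have fl: "(\<lambda>n. flux N (\<lambda>s. picard N p n s powr p) t) \<longlonglongrightarrow> flux N (\<lambda>s. u s powr p) t"
    if t: "0 \<le> t" "t < b" for t
  proof (cases "t = 0")
    case False
    have "(\<lambda>n. integral {0..t} (\<lambda>s. s ^ (N - 1) * picard N p n s powr p))
            \<longlonglongrightarrow> integral {0..t} (\<lambda>s. s ^ (N - 1) * u s powr p)"
    proof (rule dominated_convergence(2)[where h = "\<lambda>_. t ^ (N - 1) * u t powr p"])
      show "(\<lambda>s. s ^ (N - 1) * picard N p n s powr p) integrable_on {0..t}" for n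
        using flux_integrand_continuous[OF N picard_source[where b = "t + 1"], of t]
        by (intro integrable_continuous_real) auto
      show "norm (s ^ (N - 1) * picard N p n s powr p) \<le> t ^ (N - 1) * u t powr p"
        if "s \<in> {0..t}" for n s
        using that t ple[of s t n] by (auto simp: abs_mult intro!: mult_mono power_mono)
      show "(\<lambda>n. s ^ (N - 1) * picard N p n s powr p) \<longlonglongrightarrow> s ^ (N - 1) * u s powr p"
        if "s \<in> {0..t}" for s using that t by (intro tendsto_intros plim) auto
    qed auto
    thus ?thesis unfolding flux_def using False by (intro tendsto_intros) auto
  qed (simp add: flux_def)
  have F: "flux N (\<lambda>s. u s powr p) integrable_on {0..r}"
      "(\<lambda>n. integral {0..r} (flux N (\<lambda>s. picard N p n s powr p))) \<longlonglongrightarrow> integral {0..r} (flux N (\<lambda>s. u s powr p))"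
    if r: "0 \<le> r" "r < b" for r
  proof -
    have I: "flux N (\<lambda>s. picard N p n s powr p) integrable_on {0..r}" for n
      by (intro integrable_continuous_real picard_flux_continuous) auto
    have B: "norm (flux N (\<lambda>s. picard N p n s powr p) t) \<le> r * u r powr p" if "t \<in> {0..r}" for n t
    proof -
      have "flux N (\<lambda>s. picard N p n s powr p) t \<le> t * picard N p n t powr p"
        using flux_le[OF N picard_source[where b = "t + 1"], of t n] that by auto
      also have "\<dots> \<le> r * u r powr p" using ple[of t r n] that r by (intro mult_mono) auto
      finally show ?thesis using flux_nonneg[OF N picard_source[where b = "t + 1"], of t n] that by auto
    qed
    have C: "(\<lambda>n. flux N (\<lambda>s. picard N p n s powr p) t) \<longlonglongrightarrow> flux N (\<lambda>s. u s powr p) t"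
      if "t \<in> {0..r}" for t using fl that r by auto
    show "flux N (\<lambda>s. u s powr p) integrable_on {0..r}"
      by (rule dominated_convergence(1)[OF I _ B C]) auto
    show "(\<lambda>n. integral {0..r} (flux N (\<lambda>s. picard N p n s powr p))) \<longlonglongrightarrow> integral {0..r} (flux N (\<lambda>s. u s powr p))"
      by (rule dominated_convergence(2)[OF I _ B C]) auto
  qed
  have eq: "u r = 1 + integral {0..r} (flux N (\<lambda>s. u s powr p))" if r: "0 \<le> r" "r < b" for r
  proof (rule LIMSEQ_unique)
    show "(\<lambda>n. picard N p (Suc n) r) \<longlonglongrightarrow> u r" using lim[OF r] by (rule LIMSEQ_Suc)
    show "(\<lambda>n. picard N p (Suc n) r) \<longlonglongrightarrow> 1 + integral {0..r} (flux N (\<lambda>s. u s powr p))"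
      using F(2)[OF r] by (auto intro!: tendsto_intros)
  qed
  have cu: "continuous_on {0..<b} u"
    unfolding continuous_on_def
  proof
    fix t assume t: "t \<in> {0..<b}"
    then obtain c where c: "t < c" "c < b" using dense[of t b] by auto
    have "continuous_on {0..c} (\<lambda>r. 1 + integral {0..r} (flux N (\<lambda>s. u s powr p)))"
      using F(1)[of c] t c by (intro continuous_intros indefinite_integral_continuous_1) auto
    hence "continuous_on {0..c} u"
      by (rule continuous_on_cong[THEN iffD1, rotated -1]) (use eq c in auto)
    hence "(u \<longlongrightarrow> u t) (at t within {0..c})" using t c by (auto simp: continuous_on_def)
    moreover have "at t within {0..<b} = at t within {0..c}"
      by (rule at_within_nhd[of _ "{..<c}"]) (use t c in auto)
    ultimately show "(u \<longlongrightarrow> u t) (at t within {0..<b})" by simp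
  qed
  have mu: "mono_on {0..<b} u" using mono by (auto intro!: mono_onI)
  let ?v = "\<lambda>r. 1 + integral {0..r} (flux N (\<lambda>s. u s powr p))"
  show ?thesis
  proof (rule that)
    show "radial_profile N b ?v (\<lambda>r. if r = 0 then u 0 powr p / N else flux N (\<lambda>s. u s powr p) r / r)
      (\<lambda>s. u s powr p)"
      using cu mu ge1 by (intro radial_poisson[OF N] powr_source) auto
    show "mono_on {0..<b} ?v" using mu eq by (auto simp: mono_on_def)
  qed (use eq ge1 le in \<open>simp_all flip: eq\<close>)
qed

end

section \<open>Blow-up at a finite radius\<close>

lemma C2_on_subset: "C2_on S w \<Longrightarrow> T \<subseteq> S \<Longrightarrow> C2_on T w"
  unfolding C2_on_def by (blast intro: continuous_on_subset)

text \<open>A subsolution that is finite up to the boundary lies below every positive supersolution that blows up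
on the boundary.\<close>

lemma solution_le_of_blowup:
  fixes u v :: "'a::euclidean_space \<Rightarrow> real"
  assumes p: "p > 1" and R: "R > 0"
    and u: "C2_on (ball 0 R) u" "continuous_on (cball 0 R) u"
      "\<And>x. x \<in> ball 0 R \<Longrightarrow> u x powr p \<le> laplacian u x"
    and v: "C2_on (ball 0 R) v" "\<And>x. x \<in> ball 0 R \<Longrightarrow> v x > 0"
      "\<And>x. x \<in> ball 0 R \<Longrightarrow> laplacian v x \<le> v x powr p"
      "\<And>y. y \<in> frontier (ball 0 R) \<Longrightarrow> filterlim v at_top (at y within ball 0 R)"
    and x: "x \<in> ball 0 R"
  shows "u x \<le> v x"
proof (rule comparison_principle[where S = "ball 0 R" and u = u and v = v])
  fix x :: 'a assume x: "x \<in> ball 0 R" "v x < u x"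
  have "v x powr p < u x powr p" using x v(2) p by (intro powr_less_mono2) (auto simp: less_imp_le)
  thus "laplacian v x < laplacian u x" using u(3)[OF x(1)] v(3)[OF x(1)] by linarith
next
  fix y :: 'a assume y: "y \<in> frontier (ball 0 R)"
  hence "(u \<longlongrightarrow> u y) (at y within cball 0 R)"
    using u(2) R by (auto simp: continuous_on_def frontier_ball)
  hence "(u \<longlongrightarrow> u y) (at y within ball 0 R)" by (rule tendsto_within_subset) auto
  hence "eventually (\<lambda>x. u x < u y + 1) (at y within ball 0 R)"
    by (rule order_tendstoD) simp
  moreover have "eventually (\<lambda>x. v x \<ge> u y + 1) (at y within ball 0 R)"
    using v(4)[OF y] by (auto simp: filterlim_at_top)
  ultimately show "eventually (\<lambda>x. u x \<le> v x) (at y within ball 0 R)"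
    by eventually_elim linarith
qed (use assms in auto)

lemma radial_blowup:
  assumes "filterlim f at_top (at_left R)" "R > 0" "y \<in> frontier (ball (0::'a::euclidean_space) R)"
  shows "filterlim (\<lambda>x. f (norm x)) at_top (at y within ball 0 R)"
proof (rule filterlim_compose[OF assms(1)])
  have "norm y = R" using assms by (simp add: frontier_ball)
  thus "filterlim norm (at_left R) (at y within ball 0 R)"
    unfolding filterlim_at
    by (auto intro!: tendsto_eq_intros simp: eventually_at intro!: exI[of _ 1])
qed

lemma powr_neg_blowup: "a > 0 \<Longrightarrow> filterlim (\<lambda>x::real. x powr (- a)) at_top (at_right 0)"
proof -
  assume a: "a > 0"
  have "filterlim (\<lambda>x::real. - ln x) at_top (at_right 0)"
    using ln_at_0 by (simp add: filterlim_uminus_at_top)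
  hence "filterlim (\<lambda>x::real. exp (a * (- ln x))) at_top (at_right 0)"
    by (intro filterlim_compose[OF exp_at_top] filterlim_tendsto_pos_mult_at_top[OF tendsto_const a])
  thus ?thesis
    by (rule filterlim_cong[THEN iffD1, rotated -1, OF _ refl refl])
       (auto simp: eventually_at_filter powr_def)
qed

definition osserman :: "real \<Rightarrow> real \<Rightarrow> real \<Rightarrow> real \<Rightarrow> real" where
  "osserman \<alpha> c \<rho> r = c * (\<rho>\<^sup>2 - r\<^sup>2) powr (- \<alpha>)"

text \<open>With \<open>q = \<rho>\<^sup>2 - r\<^sup>2\<close> one has \<open>u' = 2 \<alpha> c r q powr (- \<alpha> - 1)\<close>, and differentiating once more gives
the bracket in the Laplacian.\<close>

lemma osserman_profile:
  assumes "\<rho> > 0"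
  shows "radial_profile N \<rho> (osserman \<alpha> c \<rho>) (\<lambda>r. 2 * \<alpha> * c * (\<rho>\<^sup>2 - r\<^sup>2) powr (- \<alpha> - 1))
     (\<lambda>r. c * (\<rho>\<^sup>2 - r\<^sup>2) powr (- \<alpha> - 2) * (2 * \<alpha> * N * (\<rho>\<^sup>2 - r\<^sup>2) + 4 * \<alpha> * (\<alpha> + 1) * r\<^sup>2))"
proof -
  have pos: "\<rho>\<^sup>2 - r\<^sup>2 > 0" if "0 \<le> r" "r < \<rho>" for r
    using power_strict_mono[of r \<rho> 2] that by simp
  have pow: "q powr (- \<alpha> - 1) = q * q powr (- \<alpha> - 2)" if "q > 0" for q :: real
  proof -
    have "q * q powr (- \<alpha> - 2) = q powr (1 + (- \<alpha> - 2))"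
      by (rule powr_mult_base) (use that in simp)
    also have "1 + (- \<alpha> - 2) = - \<alpha> - 1" by simp
    finally show ?thesis by (rule sym)
  qed
  have cont: "continuous_on {0..<\<rho>} (\<lambda>r. (\<rho>\<^sup>2 - r\<^sup>2) powr e)" for e
    by (rule continuous_on_powr) (use pos in \<open>force intro!: continuous_intros\<close>)+
  have der: "((\<lambda>r. (\<rho>\<^sup>2 - r\<^sup>2) powr e) has_real_derivative - 2 * e * r * (\<rho>\<^sup>2 - r\<^sup>2) powr (e - 1)) (at r)"
    if "0 < r" "r < \<rho>" for e r
    by (rule derivative_eq_intros refl | use pos[of r] that in simp)+
  have "(osserman \<alpha> c \<rho> has_real_derivative r * (2 * \<alpha> * c * (\<rho>\<^sup>2 - r\<^sup>2) powr (- \<alpha> - 1))) (at r)"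
    if r: "0 < r" "r < \<rho>" for r
    unfolding osserman_def using DERIV_cmult[OF der[OF r, of "- \<alpha>"], of c] by (simp add: mult_ac)
  moreover have "((\<lambda>r. 2 * \<alpha> * c * (\<rho>\<^sup>2 - r\<^sup>2) powr (- \<alpha> - 1)) has_real_derivative
      (c * (\<rho>\<^sup>2 - r\<^sup>2) powr (- \<alpha> - 2) * (2 * \<alpha> * N * (\<rho>\<^sup>2 - r\<^sup>2) + 4 * \<alpha> * (\<alpha> + 1) * r\<^sup>2)
        - N * (2 * \<alpha> * c * (\<rho>\<^sup>2 - r\<^sup>2) powr (- \<alpha> - 1))) / r) (at r)" (is "(_ has_real_derivative ?D) _")
    if r: "0 < r" "r < \<rho>" for r
  proof -
    have alg: "(c * e * (2 * \<alpha> * N * q + 4 * \<alpha> * (\<alpha> + 1) * r\<^sup>2) - N * (2 * \<alpha> * c * (q * e))) / r =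
          2 * \<alpha> * c * (- 2 * (- \<alpha> - 1) * r * e)" for q e
      using r by (simp add: field_simps power2_eq_square)
    have "?D = 2 * \<alpha> * c * (- 2 * (- \<alpha> - 1) * r * (\<rho>\<^sup>2 - r\<^sup>2) powr (- \<alpha> - 2))"
      unfolding pow[OF pos[OF less_imp_le[OF r(1)] r(2)]] by (rule alg)
    moreover have "- \<alpha> - 1 - 1 = - \<alpha> - 2" by simp
    ultimately show ?thesis
      using DERIV_cmult[OF der[OF r, of "- \<alpha> - 1"], of "2 * \<alpha> * c"] by (simp only:)
  qed
  moreover have "c * (\<rho>\<^sup>2 - 0\<^sup>2) powr (- \<alpha> - 2) * (2 * \<alpha> * N * (\<rho>\<^sup>2 - 0\<^sup>2) + 4 * \<alpha> * (\<alpha> + 1) * 0\<^sup>2) =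
      N * (2 * \<alpha> * c * (\<rho>\<^sup>2 - 0\<^sup>2) powr (- \<alpha> - 1))"
    using pow[OF pos[of 0]] assms by simp
  moreover have "continuous_on {0..<\<rho>} (osserman \<alpha> c \<rho>)"
    unfolding osserman_def by (intro continuous_on_mult continuous_on_const cont)
  moreover have "continuous_on {0..<\<rho>} (\<lambda>r. 2 * \<alpha> * c * (\<rho>\<^sup>2 - r\<^sup>2) powr (- \<alpha> - 1))"
    by (intro continuous_on_mult continuous_on_const cont)
  moreover have "continuous_on {0..<\<rho>}
      (\<lambda>r. c * (\<rho>\<^sup>2 - r\<^sup>2) powr (- \<alpha> - 2) * (2 * \<alpha> * N * (\<rho>\<^sup>2 - r\<^sup>2) + 4 * \<alpha> * (\<alpha> + 1) * r\<^sup>2))"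
    by (intro continuous_on_mult continuous_on_add continuous_on_const cont continuous_on_diff
          continuous_on_power continuous_on_id)
  ultimately show ?thesis unfolding radial_profile_def by blast
qed

lemma osserman_blowup:
  assumes "\<rho> > 0" "\<alpha> > 0" "c > 0"
  shows "filterlim (osserman \<alpha> c \<rho>) at_top (at_left \<rho>)"
proof -
  have "filterlim (\<lambda>r. \<rho>\<^sup>2 - r\<^sup>2) (at_right 0) (at_left \<rho>)"
  proof (unfold filterlim_at, intro conjI)
    show "eventually (\<lambda>r. \<rho>\<^sup>2 - r\<^sup>2 \<in> {0<..} \<and> \<rho>\<^sup>2 - r\<^sup>2 \<noteq> 0) (at_left \<rho>)"
      using eventually_at_left_real[OF assms(1)]
      by eventually_elim (auto simp: power_strict_mono)
  qed (auto intro!: tendsto_eq_intros)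
  from filterlim_compose[OF powr_neg_blowup[OF assms(2)] this]
  show ?thesis unfolding osserman_def[abs_def]
    by (intro filterlim_tendsto_pos_mult_at_top[OF tendsto_const assms(3)])
qed

text \<open>A uniform bound on the radius of existence: a solution on a ball larger than \<open>\<rho>\<close> would lie below the
Osserman function of radius \<open>\<rho>\<close>, whose value at the origin is less than 1.\<close>

lemma keller_osserman_bound:
  fixes u :: "real \<Rightarrow> real"
  assumes p: "p > 1"
  shows "\<exists>\<rho>>0. \<forall>b u h g. radial_profile DIM('a::euclidean_space) b u h g \<longrightarrow>
           (\<forall>r. 0 \<le> r \<and> r < b \<longrightarrow> g r = u r powr p) \<longrightarrow> u 0 = 1 \<longrightarrow> b \<le> \<rho>"
proof -
  define \<alpha> where "\<alpha> = 2 / (p - 1)"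
  have \<alpha>: "\<alpha> > 0" using p by (simp add: \<alpha>_def)
  have p\<alpha>: "\<alpha> * p = \<alpha> + 2" using p by (simp add: \<alpha>_def field_simps)
  let ?N = "DIM('a)"
  \<comment> \<open>\<open>\<kappa> \<rho>\<^sup>2\<close> bounds the bracket in the Laplacian of the Osserman function; \<open>c\<^sup>p\<^sup>-\<^sup>1 = \<kappa> \<rho>\<^sup>2\<close> makes it a
     supersolution, and its central value is then \<open>\<kappa> powr (\<alpha> / 2) * \<rho> powr (- \<alpha>)\<close>, which is \<open>2 powr (- \<alpha>)\<close>
     for this choice of \<open>\<rho>\<close>\<close>
  define \<kappa> where "\<kappa> = 2 * \<alpha> * ?N + 4 * \<alpha> * (\<alpha> + 1)"
  have \<kappa>: "\<kappa> > 0" using \<alpha> by (auto simp: \<kappa>_def intro!: add_nonneg_pos mult_pos_pos)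
  define \<rho> where "\<rho> = 2 * sqrt \<kappa>"
  have \<rho>: "\<rho> > 0" "\<rho>\<^sup>2 = 4 * \<kappa>" using \<kappa> by (auto simp: \<rho>_def power_mult_distrib)
  define c where "c = (2 * \<kappa>) powr \<alpha>"
  have c: "c > 0" using \<kappa> by (simp add: c_def)
  have cp: "c powr p = c * (4 * \<kappa>\<^sup>2)"
  proof -
    have "c powr p = (2 * \<kappa>) powr (\<alpha> + 2)" by (simp add: c_def powr_powr p\<alpha>)
    also have "\<dots> = c * (2 * \<kappa>)\<^sup>2" using \<kappa> by (simp add: c_def powr_add)
    finally show ?thesis by (simp add: power_mult_distrib)
  qed
  let ?z = "osserman \<alpha> c \<rho>"
  let ?G = "\<lambda>r. c * (\<rho>\<^sup>2 - r\<^sup>2) powr (- \<alpha> - 2) * (2 * \<alpha> * ?N * (\<rho>\<^sup>2 - r\<^sup>2) + 4 * \<alpha> * (\<alpha> + 1) * r\<^sup>2)"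
  have zpos: "?z r > 0" if "0 \<le> r" "r < \<rho>" for r
    using power_strict_mono[of r \<rho> 2] that c by (simp add: osserman_def)
  have super: "?G r \<le> ?z r powr p" if r: "0 \<le> r" "r < \<rho>" for r
  proof -
    have q: "\<rho>\<^sup>2 - r\<^sup>2 > 0" using power_strict_mono[of r \<rho> 2] r by simp
    hence "2 * \<alpha> * ?N * (\<rho>\<^sup>2 - r\<^sup>2) + 4 * \<alpha> * (\<alpha> + 1) * r\<^sup>2 \<le> 2 * \<alpha> * ?N * \<rho>\<^sup>2 + 4 * \<alpha> * (\<alpha> + 1) * \<rho>\<^sup>2"
      using \<alpha> by (intro add_mono mult_left_mono) auto
    also have "\<dots> = 4 * \<kappa>\<^sup>2" unfolding \<rho>(2) by (simp add: \<kappa>_def power2_eq_square algebra_simps)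
    finally have "?G r \<le> c * (\<rho>\<^sup>2 - r\<^sup>2) powr (- \<alpha> - 2) * (4 * \<kappa>\<^sup>2)"
      using c by (intro mult_left_mono) auto
    also have "\<dots> = ?z r powr p"
      using c q p\<alpha> cp by (simp add: osserman_def powr_mult powr_powr)
    finally show ?thesis .
  qed
  have z0: "?z 0 < 1"
  proof -
    have "?z 0 = (2 * \<kappa>) powr \<alpha> * (2 * (2 * \<kappa>)) powr (- \<alpha>)"
      by (simp add: osserman_def c_def \<rho>)
    also have "\<dots> = 2 powr (- \<alpha>)"
      using \<kappa> powr_mult[of 2 "2 * \<kappa>" "- \<alpha>"] by (simp add: powr_minus)
    also have "\<dots> < 2 powr 0" using \<alpha> by (intro powr_less_mono) auto
    finally show ?thesis by simp
  qed
  show ?thesis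
  proof (intro exI[of _ \<rho>] conjI allI impI \<rho>(1))
    fix b u h g
    assume prof: "radial_profile ?N b u h g" and g: "\<forall>r. 0 \<le> r \<and> r < b \<longrightarrow> g r = u r powr p"
      and u0: "u 0 = 1"
    show "b \<le> \<rho>"
    proof (rule ccontr)
      assume "\<not> b \<le> \<rho>"
      hence b: "\<rho> < b" by simp
      note U = radial_profile_C2_laplacian[OF prof]
      note Z = radial_profile_C2_laplacian[where 'a='a, OF osserman_profile[OF \<rho>(1), of _ \<alpha> c]]
      have "u (norm (0::'a)) \<le> ?z (norm (0::'a))"
      proof (rule solution_le_of_blowup[OF p \<rho>(1) _ _ _ Z(1)])
        show "C2_on (ball 0 \<rho>) (\<lambda>x::'a. u (norm x))"
          using U(1) by (rule C2_on_subset) (use b in auto)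
        show "continuous_on (cball 0 \<rho>) (\<lambda>x::'a. u (norm x))"
          by (rule continuous_on_subset[OF C2_on_imp_continuous_on[OF U(1)]]) (use b in auto)
        show "filterlim (\<lambda>x. ?z (norm x)) at_top (at y within ball 0 \<rho>)"
          if "y \<in> frontier (ball (0::'a) \<rho>)" for y
          using radial_blowup[OF osserman_blowup[OF \<rho>(1) \<alpha> c] \<rho>(1) that] .
      qed (use U(2) Z(2) b g super zpos \<rho>(1) in auto)
      thus False using z0 u0 by simp
    qed
  qed
qed

definition radial_large_solution ::
  "nat \<Rightarrow> real \<Rightarrow> real \<Rightarrow> (real \<Rightarrow> real) \<Rightarrow> (real \<Rightarrow> real) \<Rightarrow> (real \<Rightarrow> real) \<Rightarrow> bool" where
  "radial_large_solution N p R u h g \<longleftrightarrow>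
     0 < R \<and> radial_profile N R u h g \<and>
     (\<forall>r. 0 \<le> r \<and> r < R \<longrightarrow> u r > 0 \<and> g r = u r powr p) \<and>
     mono_on {0..<R} u \<and> filterlim u at_top (at_left R)"

lemma picard_extension_uniform:
  assumes "N > 0" "p > 1" "M \<ge> 1" "K \<ge> 0"
  obtains d where "d > 0"
    "\<And>r. 0 \<le> r \<Longrightarrow> r \<le> K \<Longrightarrow> (\<And>n. picard N p n r \<le> M) \<Longrightarrow> (\<forall>n. picard N p n (r + d) \<le> 2 * M)"
proof -
  define L where "L = (K + 1) * (2 * M) powr p"
  have L: "L > 0" using assms by (simp add: L_def)
  define d where "d = min 1 (M / L)"
  have d: "0 < d" "d \<le> 1" "d * L \<le> M" using assms L by (auto simp: d_def min_def field_simps)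
  show ?thesis
  proof (rule that[OF d(1)], intro allI)
    fix r n assume r: "0 \<le> r" "r \<le> K" "\<And>n. picard N p n r \<le> M"
    have "d * ((r + d) * (2 * M) powr p) \<le> d * L"
      unfolding L_def using d r by (intro mult_left_mono mult_right_mono) auto
    hence "d * ((r + d) * (2 * M) powr p) \<le> M" using d(3) by linarith
    thus "picard N p n (r + d) \<le> 2 * M"
      by (rule picard_extension[OF assms(1,2) r(1) less_imp_le[OF d(1)] _ r(3)])
  qed
qed

text \<open>The radius is the supremum of the points where the Picard iterates stay bounded. If the limit stayed
bounded up to that radius, \<open>picard_extension_uniform\<close> would carry the iterates past it.\<close>

lemma radial_large_solution_exists:
  assumes p: "p > 1"
  shows "\<exists>R u h g. radial_large_solution DIM('a::euclidean_space) p R u h g"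
proof -
  let ?N = "DIM('a)"
  have N: "?N > 0" by simp
  obtain \<rho> where \<rho>: "\<rho> > 0" "\<And>b u h g. radial_profile ?N b u h g \<Longrightarrow>
           (\<And>r. 0 \<le> r \<Longrightarrow> r < b \<Longrightarrow> g r = u r powr p) \<Longrightarrow> u 0 = 1 \<Longrightarrow> b \<le> \<rho>"
    using keller_osserman_bound[where 'a='a, OF p] by blast
  define A where "A = {r. 0 \<le> r \<and> (\<exists>M. \<forall>n. picard ?N p n r \<le> M)}"
  have down: "s \<in> A" if "r \<in> A" "0 \<le> s" "s \<le> r" for r s
    using that picard_mono[OF N p, of s r] unfolding A_def by (auto intro: order_trans)
  have A0: "picard ?N p n 0 \<le> 1" for n by (cases n) auto
  hence "0 \<in> A" by (auto simp: A_def)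
  have le: "r \<le> \<rho>" if "r \<in> A" for r
  proof -
    have "\<exists>M. \<forall>n. picard ?N p n s \<le> M" if "0 \<le> s" "s < r" for s
      using down[OF \<open>r \<in> A\<close>, of s] that by (auto simp: A_def)
    thus ?thesis
    proof (rule picard_limit[OF N p])
      fix u h g
      assume "radial_profile ?N r u h g" "\<And>s. 0 \<le> s \<Longrightarrow> s < r \<Longrightarrow> g s = u s powr p" "u 0 = 1"
      thus ?thesis by (rule \<rho>(2))
    qed
  qed
  hence bdd: "bdd_above A" by (auto simp: bdd_above_def)
  define R where "R = Sup A"
  have inA: "r \<in> A" if r: "0 \<le> r" "r < R" for r
  proof -
    obtain s where "s \<in> A" "r < s"
      using r(2) less_cSup_iff[of A r] bdd \<open>0 \<in> A\<close> unfolding R_def by auto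
    thus ?thesis using down[of s r] r by auto
  qed
  have leR: "r \<le> R" if "r \<in> A" for r unfolding R_def using that bdd by (rule cSup_upper)
  have "R > 0"
  proof -
    obtain d where "d > 0" "\<And>r. 0 \<le> r \<Longrightarrow> r \<le> 0 \<Longrightarrow> (\<And>n. picard ?N p n r \<le> 1) \<Longrightarrow>
        (\<forall>n. picard ?N p n (r + d) \<le> 2 * 1)"
      using picard_extension_uniform[OF N p, of 1 0] by auto
    hence "d \<in> A" using A0 unfolding A_def by (force intro: exI[of _ 2])
    thus ?thesis using leR \<open>d > 0\<close> by fastforce
  qed
  have bd: "\<exists>M. \<forall>n. picard ?N p n s \<le> M" if "0 \<le> s" "s < R" for s
    using inA[of s] that by (auto simp: A_def)
  have "\<exists>u h g. radial_profile ?N R u h g \<and> mono_on {0..<R} u \<and>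
      (\<forall>r. 0 \<le> r \<longrightarrow> r < R \<longrightarrow> g r = u r powr p \<and> 1 \<le> u r \<and> (\<forall>n. picard ?N p n r \<le> u r))"
    by (rule picard_limit[OF N p bd]; (intro exI conjI allI impI)?; assumption?; simp)
  then obtain u h g where u: "radial_profile ?N R u h g"
    "\<And>r. 0 \<le> r \<Longrightarrow> r < R \<Longrightarrow> g r = u r powr p"
    "\<And>r. 0 \<le> r \<Longrightarrow> r < R \<Longrightarrow> 1 \<le> u r" "mono_on {0..<R} u"
    "\<And>r n. 0 \<le> r \<Longrightarrow> r < R \<Longrightarrow> picard ?N p n r \<le> u r" by blast
  have unbounded: "\<exists>r. 0 \<le> r \<and> r < R \<and> Z \<le> u r" for Z
  proof (rule ccontr)
    assume "\<not> (\<exists>r. 0 \<le> r \<and> r < R \<and> Z \<le> u r)"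
    hence b: "u r \<le> max Z 1" if "0 \<le> r" "r < R" for r using that by force
    obtain d where d: "d > 0" "\<And>r. 0 \<le> r \<Longrightarrow> r \<le> R \<Longrightarrow> (\<And>n. picard ?N p n r \<le> max Z 1) \<Longrightarrow>
        (\<forall>n. picard ?N p n (r + d) \<le> 2 * max Z 1)"
      using picard_extension_uniform[OF N p, of "max Z 1" R] \<open>R > 0\<close> by auto
    \<comment> \<open>starting less than \<open>d\<close> before \<open>R\<close>, one step of size \<open>d\<close> leads beyond \<open>R\<close>\<close>
    define r where "r = max 0 (R - d / 2)"
    have r: "0 \<le> r" "r < R" "r + d > R" using \<open>R > 0\<close> d(1) by (auto simp: r_def)
    have "\<forall>n. picard ?N p n (r + d) \<le> 2 * max Z 1"
      using r u(5) b by (intro d(2)) (auto intro: order_trans)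
    hence "r + d \<in> A" using r d(1) by (auto simp: A_def)
    thus False using leR r by force
  qed
  have "filterlim u at_top (at_left R)"
    unfolding filterlim_at_top
  proof
    fix Z
    obtain r where r: "0 \<le> r" "r < R" "Z \<le> u r" using unbounded by blast
    show "eventually (\<lambda>s. Z \<le> u s) (at_left R)"
      using eventually_at_left_real[OF r(2)]
    proof eventually_elim
      case (elim s)
      thus ?case using mono_onD[OF u(4), of r s] r by auto
    qed
  qed
  hence "radial_large_solution ?N p R u h g"
    using u \<open>R > 0\<close> unfolding radial_large_solution_def by force
  thus ?thesis by blast
qed

section \<open>Rescaling and uniqueness\<close>

lemma radial_profile_rescale:
  assumes "radial_profile N R u h g" "l > 0"
  shows "radial_profile N (R / l) (\<lambda>r. k * u (l * r)) (\<lambda>r. k * l\<^sup>2 * h (l * r)) (\<lambda>r. k * l\<^sup>2 * g (l * r))"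
proof -
  have cont: "continuous_on {0..<R / l} (\<lambda>r. c * f (l * r))" if "continuous_on {0..<R} f" for f and c :: real
    using assms(2)
    by (intro continuous_intros continuous_on_compose2[OF that]) (auto simp: field_simps)
  have der: "((\<lambda>r. c * f (l * r)) has_real_derivative c * (D * l)) (at r)"
    if "(f has_real_derivative D) (at (l * r))" for f and c D r :: real
    using DERIV_cmult[OF DERIV_chain2[OF that DERIV_cmult_Id]] .
  show ?thesis
    unfolding radial_profile_def
  proof (intro conjI allI impI)
    fix r assume r: "0 < r \<and> r < R / l"
    hence lr: "0 < l * r" "l * r < R" using assms(2) by (auto simp: field_simps)
    have D: "(u has_real_derivative l * r * h (l * r)) (at (l * r))"
      "(h has_real_derivative (g (l * r) - N * h (l * r)) / (l * r)) (at (l * r))"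
      using assms(1) lr by (auto simp: radial_profile_def)
    show "((\<lambda>r. k * u (l * r)) has_real_derivative r * (k * l\<^sup>2 * h (l * r))) (at r)"
      using der[OF D(1), of k] by (simp add: power2_eq_square mult_ac)
    show "((\<lambda>r. k * l\<^sup>2 * h (l * r)) has_real_derivative
            (k * l\<^sup>2 * g (l * r) - N * (k * l\<^sup>2 * h (l * r))) / r) (at r)"
    proof (rule DERIV_cong[OF der[OF D(2), of "k * l\<^sup>2"]])
      show "k * l\<^sup>2 * ((g (l * r) - N * h (l * r)) / (l * r) * l) =
            (k * l\<^sup>2 * g (l * r) - N * (k * l\<^sup>2 * h (l * r))) / r"
        using assms(2) r by (simp add: field_simps)
    qed
  qed (use assms cont in \<open>auto simp: radial_profile_def\<close>)
qed

lemma radial_large_solution_rescale: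
  assumes "radial_large_solution N p R u h g" "l > 0" "p > 1"
  shows "radial_large_solution N p (R / l) (\<lambda>r. l powr (2 / (p - 1)) * u (l * r))
     (\<lambda>r. l powr (2 / (p - 1)) * l\<^sup>2 * h (l * r)) (\<lambda>r. l powr (2 / (p - 1)) * l\<^sup>2 * g (l * r))"
proof -
  define k where "k = l powr (2 / (p - 1))"
  have k: "k > 0" using assms by (simp add: k_def)
  have "k powr p = l powr (2 / (p - 1) + 2)"
    using assms(3) by (simp add: k_def powr_powr field_simps)
  \<comment> \<open>this identity is what fixes the exponent of the rescaling\<close>
  hence kp: "k powr p = k * l\<^sup>2" using assms(2) by (simp add: powr_add k_def)
  have R: "R > 0" and in_R: "0 \<le> l * r \<and> l * r < R" if "0 \<le> r" "r < R / l" for r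
    using assms that by (auto simp: radial_large_solution_def field_simps)
  have "filterlim (\<lambda>r. l * r) (at_left R) (at_left (R / l))"
    unfolding filterlim_at using assms(2)
    by (auto intro!: tendsto_eq_intros simp: eventually_at field_simps intro!: exI[of _ 1])
  from filterlim_compose[OF _ this, of u at_top]
  have "filterlim (\<lambda>r. u (l * r)) at_top (at_left (R / l))"
    using assms(1) by (auto simp: radial_large_solution_def)
  hence "filterlim (\<lambda>r. k * u (l * r)) at_top (at_left (R / l))"
    by (rule filterlim_tendsto_pos_mult_at_top[OF tendsto_const k])
  moreover have "mono_on {0..<R / l} (\<lambda>r. k * u (l * r))"
    using assms(1,2) k in_R
    by (auto simp: radial_large_solution_def intro!: mono_onI mult_left_mono elim!: mono_onD)
  moreover have "k * u (l * r) > 0 \<and> k * l\<^sup>2 * g (l * r) = (k * u (l * r)) powr p"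
    if "0 \<le> r" "r < R / l" for r
    using assms(1) in_R[OF that] k kp by (auto simp: radial_large_solution_def powr_mult)
  moreover have "R / l > 0" using assms by (auto simp: radial_large_solution_def)
  moreover have "radial_profile N (R / l) (\<lambda>r. k * u (l * r)) (\<lambda>r. k * l\<^sup>2 * h (l * r)) (\<lambda>r. k * l\<^sup>2 * g (l * r))"
    using assms by (intro radial_profile_rescale) (auto simp: radial_large_solution_def)
  ultimately show ?thesis unfolding k_def[symmetric] radial_large_solution_def by blast
qed

corollary radial_large_solution_unit:
  assumes "p > 1"
  obtains u h g where "radial_large_solution DIM('a::euclidean_space) p 1 u h g"
proof -
  obtain R u h g where *: "radial_large_solution DIM('a) p R u h g"
    using radial_large_solution_exists[OF assms] by blast
  hence "R > 0" by (simp add: radial_large_solution_def)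
  thus ?thesis using that radial_large_solution_rescale[OF * \<open>R > 0\<close> assms] by simp
qed

lemma radial_large_solution_laplacian:
  assumes "radial_large_solution DIM('a) p R u h g"
  shows "C2_on (ball 0 R) (\<lambda>x::'a::euclidean_space. u (norm x))"
    and "\<And>x::'a. x \<in> ball 0 R \<Longrightarrow> laplacian (\<lambda>x. u (norm x)) x = u (norm x) powr p"
    and "\<And>x::'a. x \<in> ball 0 R \<Longrightarrow> u (norm x) > 0"
    and "\<And>y::'a. y \<in> frontier (ball 0 R) \<Longrightarrow> filterlim (\<lambda>x. u (norm x)) at_top (at y within ball 0 R)"
proof -
  have R: "0 < R" "radial_profile DIM('a) R u h g" "filterlim u at_top (at_left R)"
    and ug: "\<And>r. 0 \<le> r \<Longrightarrow> r < R \<Longrightarrow> u r > 0 \<and> g r = u r powr p"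
    using assms by (auto simp: radial_large_solution_def)
  show "C2_on (ball 0 R) (\<lambda>x::'a. u (norm x))" by (rule radial_profile_C2_laplacian[OF R(2)])
  show "laplacian (\<lambda>x. u (norm x)) x = u (norm x) powr p" if "x \<in> ball 0 R" for x :: 'a
    using radial_profile_C2_laplacian(2)[OF R(2), of x] ug[of "norm x"] that by simp
  show "u (norm x) > 0" if "x \<in> ball 0 R" for x :: 'a
    using ug[of "norm x"] that by simp
  show "filterlim (\<lambda>x. u (norm x)) at_top (at y within ball 0 R)" if "y \<in> frontier (ball 0 R)" for y :: 'a
    using radial_blowup[OF R(3,1) that] .
qed

lemma radial_large_solution_positive_large_solution:
  assumes "radial_large_solution DIM('a) p 1 u h g"
  shows "positive_large_solution (\<lambda>t. t powr p) (\<lambda>x::'a::euclidean_space. u (norm x))"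
  unfolding positive_large_solution_def large_solution_def
  using radial_large_solution_laplacian[OF assms] by blast

lemma rescaling_tendsto:
  assumes "radial_large_solution N p R u h g" "0 \<le> s" "s < R"
  shows "((\<lambda>l. l powr a * u (l * s)) \<longlongrightarrow> u s) (at 1 within L)"
proof -
  have "((\<lambda>l. l powr a * u (l * s)) \<longlongrightarrow> 1 powr a * u (1 * s)) (at 1)"
  proof (cases "s = 0")
    case False
    hence "(u has_real_derivative s * h s) (at s)"
      using assms by (simp add: radial_large_solution_def radial_profile_def)
    hence "isCont u (1 * s)" using DERIV_isCont by simp
    thus ?thesis by (intro tendsto_intros isCont_tendsto_compose[of _ u]) auto
  qed (auto intro!: tendsto_eq_intros)
  thus ?thesis by (auto intro: tendsto_within_subset)
qed

text \<open>Squeeze an arbitrary large solution \<open>v\<close> between rescalings of the radial one that blow up slightly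
inside and slightly outside the unit sphere.\<close>

theorem positive_large_solution_radial:
  fixes v :: "'a::euclidean_space \<Rightarrow> real"
  assumes p: "p > 1" and u: "radial_large_solution DIM('a) p 1 u h g"
    and v: "positive_large_solution (\<lambda>t. t powr p) v" and x: "x \<in> ball 0 1"
  shows "v x = u (norm x)"
proof (rule antisym)
  let ?U = "\<lambda>l r. l powr (2 / (p - 1)) * u (l * r)"
  have vD: "C2_on (ball 0 1) v" "\<And>x. x \<in> ball 0 1 \<Longrightarrow> laplacian v x = v x powr p"
    "\<And>x. x \<in> ball 0 1 \<Longrightarrow> v x > 0"
    "\<And>y. y \<in> frontier (ball 0 1) \<Longrightarrow> filterlim v at_top (at y within ball 0 1)"
    using v by (auto simp: positive_large_solution_def large_solution_def)
  have U: "C2_on (ball 0 (1 / l)) (\<lambda>x::'a. ?U l (norm x))"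
    "\<And>x::'a. x \<in> ball 0 (1 / l) \<Longrightarrow> laplacian (\<lambda>x. ?U l (norm x)) x = ?U l (norm x) powr p"
    "\<And>x::'a. x \<in> ball 0 (1 / l) \<Longrightarrow> ?U l (norm x) > 0"
    "\<And>y::'a. y \<in> frontier (ball 0 (1 / l)) \<Longrightarrow> filterlim (\<lambda>x. ?U l (norm x)) at_top (at y within ball 0 (1 / l))"
    if "l > 0" for l
    using radial_large_solution_laplacian[OF radial_large_solution_rescale[OF u that p]] by blast+
  have lim: "((\<lambda>l. ?U l (norm x)) \<longlongrightarrow> u (norm x)) (at 1 within L)" for L
    using rescaling_tendsto[OF u, of "norm x"] x by simp
  show "v x \<le> u (norm x)"
  proof (rule tendsto_lowerbound[OF lim])
    have "((\<lambda>l. l * norm x) \<longlongrightarrow> 1 * norm x) (at_right 1)" by (intro tendsto_intros)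
    hence "eventually (\<lambda>l. l * norm x < 1) (at_right 1)"
      by (rule order_tendstoD) (use x in auto)
    moreover have "eventually (\<lambda>l::real. l > 1) (at_right 1)" by (simp add: eventually_at_filter)
    ultimately show "eventually (\<lambda>l. v x \<le> ?U l (norm x)) (at_right 1)"
    proof eventually_elim
      case (elim l)
      have s: "ball 0 (1 / l) \<subseteq> ball (0::'a) 1" "cball 0 (1 / l) \<subseteq> ball (0::'a) 1"
        using elim by (auto simp: divide_le_eq less_le_trans le_less_trans)
      show ?case
        by (rule solution_le_of_blowup[OF p _ C2_on_subset[OF vD(1) s(1)]
              continuous_on_subset[OF C2_on_imp_continuous_on[OF vD(1)] s(2)] _ U(1)])
           (use elim U vD s x in \<open>auto simp: field_simps\<close>)
    qed
  qed simp
  show "u (norm x) \<le> v x"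
  proof (rule tendsto_upperbound[OF lim])
    show "eventually (\<lambda>l. ?U l (norm x) \<le> v x) (at_left 1)"
      using eventually_at_left_real[of 0 1, OF zero_less_one]
    proof eventually_elim
      case (elim l)
      have "1 < 1 / l" using elim by (simp add: less_divide_eq)
      hence s: "ball 0 1 \<subseteq> ball (0::'a) (1 / l)" "cball 0 1 \<subseteq> ball (0::'a) (1 / l)" by auto
      show ?case
        by (rule solution_le_of_blowup[OF p _ C2_on_subset[OF U(1) s(1)]
              continuous_on_subset[OF C2_on_imp_continuous_on[OF U(1)] s(2)] _ vD(1)])
           (use elim U vD s x in auto)
    qed
  qed simp
qed

section \<open>The formal expansion at the boundary\<close>

text \<open>Polynomial approximation to order \<open>k\<close> at \<open>0+\<close>: a Taylor expansion without any derivatives, which makes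
closure under products and powers elementary.\<close>

definition poly_approx :: "nat \<Rightarrow> (real \<Rightarrow> real) \<Rightarrow> bool" where
  "poly_approx k f \<longleftrightarrow> (\<exists>q. (\<lambda>d. f d - poly q d) \<in> O[at_right 0](\<lambda>d. d ^ k))"

lemma poly_tendsto_0: "(poly q \<longlongrightarrow> poly q 0) (at_right (0::real))"
  using poly_isCont[where p = q and x = 0] by (auto simp: isCont_def intro: tendsto_within_subset)

lemma poly_bigo_1: "poly q \<in> O[at_right 0](\<lambda>_. 1 :: real)"
  by (rule bigoI_tendsto[of _ _ "poly q 0"]) (use poly_tendsto_0 in auto)

lemma power_bigo_1: "(\<lambda>d. d ^ k) \<in> O[at_right 0](\<lambda>_. 1 :: real)"
proof -
  have "poly (monom 1 k) = (\<lambda>d::real. d ^ k)" by (simp add: poly_monom fun_eq_iff)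
  thus ?thesis using poly_bigo_1[of "monom 1 k"] by simp
qed

lemma poly_approx_poly: "poly_approx k (poly q)"
  unfolding poly_approx_def by (rule exI[of _ q]) simp

lemma poly_approx_diff:
  assumes "poly_approx k f" "poly_approx k g"
  shows "poly_approx k (\<lambda>d. f d - g d)"
proof -
  obtain q r where "(\<lambda>d. f d - poly q d) \<in> O[at_right 0](\<lambda>d. d ^ k)"
    "(\<lambda>d. g d - poly r d) \<in> O[at_right 0](\<lambda>d. d ^ k)"
    using assms unfolding poly_approx_def by blast
  from sum_in_bigo(2)[OF this] show ?thesis
    unfolding poly_approx_def by (intro exI[of _ "q - r"]) (simp add: algebra_simps)
qed

lemma poly_approx_mult:
  assumes "poly_approx k f" "poly_approx k g"
  shows "poly_approx k (\<lambda>d. f d * g d)"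
proof -
  obtain q r where q: "(\<lambda>d. f d - poly q d) \<in> O[at_right 0](\<lambda>d. d ^ k)"
    and r: "(\<lambda>d. g d - poly r d) \<in> O[at_right 0](\<lambda>d. d ^ k)"
    using assms unfolding poly_approx_def by blast
  have g: "g \<in> O[at_right 0](\<lambda>_. 1)"
    using sum_in_bigo(1)[OF landau_o.big_trans[OF r power_bigo_1] poly_bigo_1[of r]] by simp
  have "(\<lambda>d. (f d - poly q d) * g d + poly q d * (g d - poly r d)) \<in> O[at_right 0](\<lambda>d. d ^ k)"
    using landau_o.big.mult[OF q g] landau_o.big.mult[OF poly_bigo_1[of q] r]
    by (intro sum_in_bigo) simp_all
  thus ?thesis
    unfolding poly_approx_def by (intro exI[of _ "q * r"]) (simp add: algebra_simps)
qed

lemma poly_approx_geometric: "poly_approx k (\<lambda>d. 1 / (1 - d))"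
proof -
  define q :: "real poly" where "q = (\<Sum>j<k. monom 1 j)"
  have "((\<lambda>d::real. 1 / (1 - d)) \<longlongrightarrow> 1 / (1 - 0)) (at_right 0)"
    by (intro tendsto_intros) auto
  hence "(\<lambda>d::real. 1 / (1 - d)) \<in> O[at_right 0](\<lambda>_. 1)"
    by (intro bigoI_tendsto[of _ _ 1]) auto
  from landau_o.big.mult[OF landau_o.big_refl[of "\<lambda>d::real. d ^ k"] this]
  have "(\<lambda>d::real. d ^ k * (1 / (1 - d))) \<in> O[at_right 0](\<lambda>d. d ^ k)" by simp
  moreover have "eventually (\<lambda>d::real. d ^ k * (1 / (1 - d)) = 1 / (1 - d) - poly q d) (at_right 0)"
    using eventually_at_right_real[OF zero_less_one]
  proof eventually_elim
    case (elim d)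
    have "poly q d = (\<Sum>j<k. d ^ j)" by (simp add: q_def poly_sum poly_monom)
    also have "\<dots> = (1 - d ^ k) / (1 - d)" using elim by (intro sum_gp_strict[THEN trans]) auto
    finally show ?case using elim by (simp add: field_simps)
  qed
  ultimately have "(\<lambda>d. 1 / (1 - d) - poly q d) \<in> O[at_right 0](\<lambda>d. d ^ k)"
    by (rule landau_o.big.in_cong[THEN iffD1, rotated])
  thus ?thesis unfolding poly_approx_def by blast
qed

lemma binomial_series_tail:
  fixes p :: real
  obtains C where "\<And>w. \<bar>w\<bar> \<le> 1 / 2 \<Longrightarrow>
    \<bar>(1 + w) powr p - (\<Sum>j<k. (p gchoose j) * w ^ j)\<bar> \<le> C * \<bar>w\<bar> ^ k"
proof -
  let ?f = "\<lambda>j. p gchoose j"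
  have "summable (\<lambda>j. ?f j * (3/4) ^ j)"
    using gen_binomial_real[of "3/4" p] by (auto intro: sums_summable)
  hence "summable (\<lambda>j. norm (?f j * (1/2) ^ j))" by (rule powser_insidea) simp
  \<comment> \<open>convergence at 3/4 gives absolute convergence at 1/2, which bounds the tail uniformly\<close>
  hence sum: "summable (\<lambda>i. norm (?f (i + k) * (1/2) ^ (i + k)))"
    by (subst summable_iff_shift[of "\<lambda>i. norm (?f i * (1/2) ^ i)"])
  show ?thesis
  proof (rule that)
    fix w :: real assume w: "\<bar>w\<bar> \<le> 1 / 2"
    have le: "norm (?f (i + k) * w ^ (i + k)) \<le> norm (?f (i + k) * (1/2) ^ (i + k)) * (2 * \<bar>w\<bar>) ^ k" for i
    proof -
      have "\<bar>w\<bar> ^ (i + k) = \<bar>w\<bar> ^ i * \<bar>w\<bar> ^ k" by (rule power_add)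
      also have "\<dots> \<le> (1/2) ^ i * \<bar>w\<bar> ^ k" using w by (intro mult_right_mono power_mono) auto
      also have "\<dots> = (1/2) ^ (i + k) * (2 * \<bar>w\<bar>) ^ k" by (simp add: power_add power_mult_distrib power_divide)
      finally show ?thesis
        by (simp add: abs_mult power_abs mult.assoc mult_left_mono)
    qed
    have "(\<lambda>i. ?f (i + k) * w ^ (i + k)) sums ((1 + w) powr p - (\<Sum>j<k. ?f j * w ^ j))"
      using w by (intro sums_split_initial_segment gen_binomial_real) auto
    hence "\<bar>(1 + w) powr p - (\<Sum>j<k. ?f j * w ^ j)\<bar> = norm (\<Sum>i. ?f (i + k) * w ^ (i + k))"
      by (simp add: sums_iff)
    also have "\<dots> \<le> (\<Sum>i. norm (?f (i + k) * (1/2) ^ (i + k)) * (2 * \<bar>w\<bar>) ^ k)"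
      by (rule norm_suminf_le[OF le summable_mult2[OF sum]])
    also have "\<dots> = (\<Sum>i. norm (?f (i + k) * (1/2) ^ (i + k))) * (2 * \<bar>w\<bar>) ^ k"
      by (rule suminf_mult2[OF sum, symmetric])
    finally show "\<bar>(1 + w) powr p - (\<Sum>j<k. ?f j * w ^ j)\<bar> \<le>
       ((\<Sum>i. norm (?f (i + k) * (1/2) ^ (i + k))) * 2 ^ k) * \<bar>w\<bar> ^ k"
      by (simp add: power_mult_distrib mult_ac)
  qed
qed

text \<open>Factor out \<open>P(0)\<^sup>p\<close>; what remains is \<open>(1 + W)\<^sup>p\<close> for a polynomial \<open>W\<close> vanishing at 0, and truncating
the binomial series after \<open>k\<close> terms costs \<open>O(W\<^sup>k) = O(d\<^sup>k)\<close>.\<close>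

lemma poly_approx_powr:
  assumes "poly P 0 > 0"
  shows "poly_approx k (\<lambda>d. poly P d powr p)"
proof -
  define a where "a = poly P 0"
  define W where "W = smult (1 / a) P - 1"
  have a: "a > 0" using assms by (simp add: a_def)
  have W: "poly P d = a * (1 + poly W d)" for d using a by (simp add: W_def)
  have W0: "poly W 0 = 0" using a by (simp add: W_def a_def)
  then obtain V where V: "W = [:0, 1:] * V" using poly_eq_0_iff_dvd[of W 0] by (auto elim: dvdE)
  define q where "q = smult (a powr p) (\<Sum>j<k. smult (p gchoose j) (W ^ j))"
  obtain C where C: "\<And>w. \<bar>w\<bar> \<le> 1 / 2 \<Longrightarrow>
    \<bar>(1 + w) powr p - (\<Sum>j<k. (p gchoose j) * w ^ j)\<bar> \<le> C * \<bar>w\<bar> ^ k"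
    using binomial_series_tail by blast
  have small: "eventually (\<lambda>d. \<bar>poly W d\<bar> < 1 / 2) (at_right 0)"
    using tendsto_rabs[OF poly_tendsto_0[of W]] W0 by (intro order_tendstoD(2)) auto
  have "(\<lambda>d. poly P d powr p - poly q d) \<in> O[at_right 0](\<lambda>d. poly W d ^ k)"
  proof (rule bigoI[of _ "a powr p * C"], use small in eventually_elim)
    case (elim d)
    have "poly P d powr p = a powr p * (1 + poly W d) powr p"
      unfolding W using a elim by (intro powr_mult)
    hence "\<bar>poly P d powr p - poly q d\<bar> =
           a powr p * \<bar>(1 + poly W d) powr p - (\<Sum>j<k. (p gchoose j) * poly W d ^ j)\<bar>"
      by (simp add: q_def poly_sum abs_mult flip: right_diff_distrib)
    also have "\<dots> \<le> a powr p * (C * \<bar>poly W d\<bar> ^ k)"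
      using C[of "poly W d"] elim by (intro mult_left_mono) auto
    finally show ?case by (simp add: power_abs mult.assoc)
  qed
  also have "(\<lambda>d. poly W d ^ k) = (\<lambda>d. d ^ k * poly (V ^ k) d)"
    by (simp add: V power_mult_distrib)
  also have "(\<lambda>d. d ^ k * poly (V ^ k) d) \<in> O[at_right 0](\<lambda>d. d ^ k)"
    using landau_o.big.mult[OF landau_o.big_refl[of "\<lambda>d::real. d ^ k"] poly_bigo_1[of "V ^ k"]] by simp
  finally show ?thesis unfolding poly_approx_def by blast
qed

lemma poly_vanishing_dvd:
  assumes "((\<lambda>d::real. poly q d / d ^ k) \<longlongrightarrow> 0) (at_right 0)"
  obtains r where "q = monom 1 (Suc k) * r"
  using assms
proof (induction k arbitrary: q thesis)
  case 0
  hence "poly q 0 = 0" using tendsto_unique[OF _ poly_tendsto_0, of q 0] by simp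
  then obtain r where "q = [:0, 1:] * r" using poly_eq_0_iff_dvd[of q 0] by (auto elim: dvdE)
  thus ?case using 0(1)[of r] by (simp add: monom_Suc monom_0)
next
  case (Suc k)
  have "((\<lambda>d::real. poly q d / d ^ Suc k * d ^ Suc k) \<longlongrightarrow> 0 * 0 ^ Suc k) (at_right 0)"
    by (intro tendsto_intros Suc.prems)
  moreover have "eventually (\<lambda>d::real. poly q d / d ^ Suc k * d ^ Suc k = poly q d) (at_right 0)"
    by (auto simp: eventually_at_filter)
  ultimately have "((\<lambda>d. poly q d) \<longlongrightarrow> 0) (at_right 0)"
    by (simp add: tendsto_cong)
  hence "poly q 0 = 0" using tendsto_unique[OF _ poly_tendsto_0, of q 0] by simp
  then obtain s where s: "q = [:0, 1:] * s" using poly_eq_0_iff_dvd[of q 0] by (auto elim: dvdE)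
  have "eventually (\<lambda>d::real. poly q d / d ^ Suc k = poly s d / d ^ k) (at_right 0)"
    by (auto simp: eventually_at_filter s)
  hence "((\<lambda>d. poly s d / d ^ k) \<longlongrightarrow> 0) (at_right 0)"
    using Suc.prems(2) by (simp add: tendsto_cong)
  then obtain r where "s = monom 1 (Suc k) * r" using Suc.IH by blast
  hence "q = monom 1 (Suc (Suc k)) * r" unfolding s by (simp add: monom_Suc[of 1 "Suc k"])
  thus ?case using Suc.prems(1) by blast
qed

text \<open>A function with polynomial approximations cannot vanish to a fractional order: if it is \<open>o(d\<^sup>k)\<close>, its
next Taylor coefficient exists.\<close>

lemma poly_approx_next_order:
  assumes f: "poly_approx (k + 2) f" and lim: "((\<lambda>d. f d / d ^ k) \<longlongrightarrow> 0) (at_right 0)"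
  obtains c where "((\<lambda>d. f d / d ^ Suc k) \<longlongrightarrow> c) (at_right 0)"
proof -
  obtain q where q: "(\<lambda>d. f d - poly q d) \<in> O[at_right 0](\<lambda>d. d ^ (k + 2))"
    using f unfolding poly_approx_def by blast
  have rem: "((\<lambda>d. (f d - poly q d) / d ^ j) \<longlongrightarrow> 0) (at_right 0)" if "j < k + 2" for j
  proof -
    have "(\<lambda>d::real. d ^ (k + 2)) \<in> o[at_right 0](\<lambda>d. d ^ j)"
    proof (rule smalloI_tendsto)
      have "((\<lambda>d::real. d ^ (k + 2 - j)) \<longlongrightarrow> 0 ^ (k + 2 - j)) (at_right 0)"
        by (intro tendsto_intros)
      moreover have "eventually (\<lambda>d::real. d ^ (k + 2) / d ^ j = d ^ (k + 2 - j)) (at_right 0)"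
        using that by (auto simp: eventually_at_filter power_diff simp del: power_Suc)
      ultimately show "((\<lambda>d::real. d ^ (k + 2) / d ^ j) \<longlongrightarrow> 0) (at_right 0)"
        using that by (simp add: tendsto_cong zero_power)
      show "eventually (\<lambda>d::real. d ^ j \<noteq> 0) (at_right 0)"
        by (rule eventually_mono[OF eventually_at_right_less]) simp
    qed
    from landau_o.big_small_trans[OF q this] show ?thesis by (rule smalloD_tendsto)
  qed
  have "((\<lambda>d. f d / d ^ k - (f d - poly q d) / d ^ k) \<longlongrightarrow> 0 - 0) (at_right 0)"
    by (intro tendsto_diff lim rem) simp
  hence "((\<lambda>d. poly q d / d ^ k) \<longlongrightarrow> 0) (at_right 0)"
    by (simp flip: diff_divide_distrib)
  then obtain r where r: "q = monom 1 (Suc k) * r" by (rule poly_vanishing_dvd)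
  have "((\<lambda>d. (f d - poly q d) / d ^ Suc k + poly r d) \<longlongrightarrow> 0 + poly r 0) (at_right 0)"
    by (intro tendsto_add rem poly_tendsto_0) simp
  moreover have "eventually (\<lambda>d. (f d - poly q d) / d ^ Suc k + poly r d = f d / d ^ Suc k) (at_right 0)"
    by (auto simp: eventually_at_filter r poly_monom diff_divide_distrib)
  ultimately have "((\<lambda>d. f d / d ^ Suc k) \<longlongrightarrow> 0 + poly r 0) (at_right 0)"
    using tendsto_cong by fast
  thus ?thesis by (rule that)
qed

text \<open>\<open>d P' - \<alpha> P\<close>, which multiplies the coefficient of \<open>d\<^sup>k\<close> by \<open>k - \<alpha>\<close>. It describes how differentiation acts
on \<open>d powr (- \<alpha>) * P(d)\<close>.\<close>

definition euler_op :: "real \<Rightarrow> real poly \<Rightarrow> real poly" where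
  "euler_op \<alpha> P = [:0, 1:] * pderiv P - smult \<alpha> P"

lemma euler_op_add: "euler_op \<alpha> (P + Q) = euler_op \<alpha> P + euler_op \<alpha> Q"
  by (simp add: euler_op_def pderiv_add smult_add_right algebra_simps)

lemma euler_op_monom: "euler_op \<alpha> (monom a m) = monom ((m - \<alpha>) * a) m"
  by (rule poly_eqI) (auto simp: euler_op_def coeff_pderiv coeff_pCons split: nat.split simp: algebra_simps)

text \<open>For \<open>A(d) = d powr (- \<alpha>) * P(d)\<close> this is \<open>A'' - n / (1 - d) A' - A\<^sup>p\<close>, the defect in the radial equation
written in \<open>d = 1 - r\<close> with \<open>n = N - 1\<close>, multiplied by \<open>d powr (\<alpha> + 2)\<close>.\<close>

definition residual :: "real \<Rightarrow> real \<Rightarrow> real \<Rightarrow> real poly \<Rightarrow> real \<Rightarrow> real" where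
  "residual n \<alpha> p P d = poly (euler_op (\<alpha> + 1) (euler_op \<alpha> P)) d
     - n * d / (1 - d) * poly (euler_op \<alpha> P) d - poly P d powr p"

lemma residual_poly_approx:
  assumes "poly P 0 > 0"
  shows "poly_approx k (residual n \<alpha> p P)"
proof -
  have "poly_approx k (\<lambda>d. poly (euler_op (\<alpha> + 1) (euler_op \<alpha> P)) d
     - 1 / (1 - d) * poly ([:0, n:] * euler_op \<alpha> P) d - poly P d powr p)"
    by (intro poly_approx_diff poly_approx_mult poly_approx_poly poly_approx_geometric
          poly_approx_powr assms)
  thus ?thesis by (simp add: residual_def[abs_def] mult_ac)
qed

text \<open>Strict differentiability of \<open>t \<mapsto> t\<^sup>p\<close> at \<open>c\<close>, with the intermediate point of the mean value theorem
chosen for each \<open>t\<close>.\<close>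

lemma powr_difference_quotient:
  fixes X Y :: "'a \<Rightarrow> real"
  assumes X: "(X \<longlongrightarrow> c) F" and Y: "(Y \<longlongrightarrow> c) F" and c: "c > 0"
  obtains z where "((\<lambda>t. p * z t powr (p - 1)) \<longlongrightarrow> p * c powr (p - 1)) F"
    "eventually (\<lambda>t. X t powr p - Y t powr p = p * z t powr (p - 1) * (X t - Y t)) F"
proof -
  have mv: "\<exists>z. min x y \<le> z \<and> z \<le> max x y \<and> x powr p - y powr p = p * z powr (p - 1) * (x - y)"
    if xy: "x > 0" "y > 0" for x y
  proof -
    have *: "\<exists>z. x \<le> z \<and> z \<le> y \<and> y powr p - x powr p = p * z powr (p - 1) * (y - x)"
      if "0 < x" "x < y" for x y
    proof -
      have "((\<lambda>x. x powr p) has_real_derivative p * z powr (p - 1)) (at z)" if "x \<le> z" for z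
        using that \<open>0 < x\<close> by (intro has_real_derivative_powr) simp
      from MVT2[OF \<open>x < y\<close> this] obtain z where
        "x < z" "z < y" "y powr p - x powr p = (y - x) * (p * z powr (p - 1))" by blast
      thus ?thesis by (intro exI[of _ z]) (simp add: mult_ac)
    qed
    consider "x = y" | "x < y" | "y < x" by linarith
    thus ?thesis
    proof cases
      case 2
      obtain z where z: "x \<le> z" "z \<le> y" "y powr p - x powr p = p * z powr (p - 1) * (y - x)"
        using *[OF xy(1) 2] by blast
      have "x powr p - y powr p = - (y powr p - x powr p)" by simp
      also have "\<dots> = p * z powr (p - 1) * (x - y)" unfolding z(3) by (simp add: right_diff_distrib)
      finally show ?thesis using z 2 by (intro exI[of _ z]) simp
    next
      case 3
      show ?thesis using *[OF xy(2) 3] 3 by simp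
    qed auto
  qed
  define z where "z t = (SOME z. min (X t) (Y t) \<le> z \<and> z \<le> max (X t) (Y t) \<and>
     X t powr p - Y t powr p = p * z powr (p - 1) * (X t - Y t))" for t
  have "eventually (\<lambda>t. X t > 0) F" "eventually (\<lambda>t. Y t > 0) F"
    using order_tendstoD(1)[OF X c] order_tendstoD(1)[OF Y c] .
  hence z: "eventually (\<lambda>t. min (X t) (Y t) \<le> z t \<and> z t \<le> max (X t) (Y t) \<and>
     X t powr p - Y t powr p = p * z t powr (p - 1) * (X t - Y t)) F"
  proof eventually_elim
    case (elim t)
    from someI_ex[OF mv[OF elim]] show ?case unfolding z_def .
  qed
  have "(z \<longlongrightarrow> c) F"
  proof (rule tendsto_sandwich)
    show "((\<lambda>t. min (X t) (Y t)) \<longlongrightarrow> c) F" using tendsto_min[OF X Y] by simp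
    show "((\<lambda>t. max (X t) (Y t)) \<longlongrightarrow> c) F" using tendsto_max[OF X Y] by simp
  qed (use z in \<open>eventually_elim, blast\<close>)+
  hence "((\<lambda>t. p * z t powr (p - 1)) \<longlongrightarrow> p * c powr (p - 1)) F"
    using c by (intro tendsto_intros) auto
  moreover have "eventually (\<lambda>t. X t powr p - Y t powr p = p * z t powr (p - 1) * (X t - Y t)) F"
    using z by eventually_elim blast
  ultimately show ?thesis by (rule that)
qed

text \<open>The effect of one further coefficient on the residual, to leading order: the linear part contributes
\<open>(m - \<alpha>) (m - \<alpha> - 1)\<close>, the drift is of higher order, and the nonlinearity contributes
\<open>- p c\<^sup>p\<^sup>-\<^sup>1\<close>.\<close>

lemma residual_add_monom:
  assumes P: "poly P 0 = c" "c > 0" and m: "m > 0"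
    and lim: "((\<lambda>d. residual n \<alpha> p P d / d ^ m) \<longlongrightarrow> l) (at_right 0)"
  shows "((\<lambda>d. residual n \<alpha> p (P + monom a m) d / d ^ m) \<longlongrightarrow>
            l + a * ((m - \<alpha>) * (m - \<alpha> - 1) - p * c powr (p - 1))) (at_right 0)"
proof -
  let ?P = "P + monom a m"
  have "poly ?P 0 = c" using P m by (simp add: poly_monom zero_power)
  hence lims: "(poly ?P \<longlongrightarrow> c) (at_right 0)" "(poly P \<longlongrightarrow> c) (at_right 0)"
    using poly_tendsto_0[of ?P] poly_tendsto_0[of P] P(1) by simp_all
  obtain z where z: "((\<lambda>d. p * z d powr (p - 1)) \<longlongrightarrow> p * c powr (p - 1)) (at_right 0)"
    "eventually (\<lambda>d. poly ?P d powr p - poly P d powr p = p * z d powr (p - 1) * (poly ?P d - poly P d)) (at_right 0)"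
    by (rule powr_difference_quotient[OF lims P(2)])
  have "((\<lambda>d. residual n \<alpha> p P d / d ^ m + a * ((m - \<alpha>) * (m - \<alpha> - 1) - n * d / (1 - d) * (m - \<alpha>) - p * z d powr (p - 1)))
     \<longlongrightarrow> l + a * ((m - \<alpha>) * (m - \<alpha> - 1) - n * 0 / (1 - 0) * (m - \<alpha>) - p * c powr (p - 1))) (at_right 0)"
    by (intro tendsto_intros lim z(1)) auto
  moreover have "eventually (\<lambda>d. residual n \<alpha> p P d / d ^ m + a * ((m - \<alpha>) * (m - \<alpha> - 1) - n * d / (1 - d) * (m - \<alpha>) - p * z d powr (p - 1))
      = residual n \<alpha> p ?P d / d ^ m) (at_right 0)"
    using z(2) eventually_at_right_real[OF zero_less_one]
  proof eventually_elim
    case (elim d)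
    have eq: "poly ?P d powr p = poly P d powr p + p * z d powr (p - 1) * (a * d ^ m)"
      using elim(1) by (simp add: poly_monom)
    define t where "t = n * d / (1 - d)"
    have "residual n \<alpha> p ?P d = residual n \<alpha> p P d +
       d ^ m * (a * ((m - \<alpha>) * (m - \<alpha> - 1) - t * (m - \<alpha>) - p * z d powr (p - 1)))"
      unfolding residual_def eq t_def[symmetric]
      unfolding euler_op_add euler_op_monom poly_add poly_monom by (simp add: algebra_simps)
    thus ?case using elim(2) by (simp add: add_divide_distrib t_def)
  qed
  ultimately show ?thesis by (simp add: tendsto_cong)
qed

text \<open>The constant term \<open>c\<close> is dictated by \<open>c\<^sup>p\<^sup>-\<^sup>1 = \<alpha> (\<alpha> + 1)\<close>. Every later coefficient up to order \<open>[\<alpha>]\<close> is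
then determined, because the factor in \<open>residual_add_monom\<close> is negative.\<close>

lemma formal_expansion:
  fixes n p \<alpha> :: real
  assumes \<alpha>: "\<alpha> > 0" and p\<alpha>: "p * \<alpha> = \<alpha> + 2"
  obtains P C \<delta> where "degree P \<le> nat \<lfloor>\<alpha>\<rfloor>" "poly P 0 > 0" "poly P 0 powr (p - 1) = \<alpha> * (\<alpha> + 1)"
    "\<delta> > 0" "\<And>d. 0 < d \<Longrightarrow> d < \<delta> \<Longrightarrow> \<bar>residual n \<alpha> p P d\<bar> \<le> C * d ^ Suc (nat \<lfloor>\<alpha>\<rfloor>)"
proof -
  have "(p - 1) * \<alpha> = 2" using p\<alpha> by (simp add: algebra_simps)
  hence p: "p > 1" using \<alpha> by (metis diff_gt_0_iff_gt zero_less_mult_pos2 zero_less_numeral)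
  define c where "c = (\<alpha> * (\<alpha> + 1)) powr (1 / (p - 1))"
  have c: "c > 0" "c powr (p - 1) = \<alpha> * (\<alpha> + 1)"
    using \<alpha> p by (auto simp: c_def powr_powr)
  have cp: "c powr p = c * (\<alpha> * (\<alpha> + 1))"
    using powr_mult_base[of c "p - 1"] c by simp
  have step: "\<exists>P. degree P \<le> k \<and> poly P 0 = c \<and>
      ((\<lambda>d. residual n \<alpha> p P d / d ^ k) \<longlongrightarrow> 0) (at_right 0)" if "real k \<le> \<alpha>" for k
    using that
  proof (induction k)
    case 0
    let ?P = "[:c:]"
    have "((\<lambda>d. poly (euler_op (\<alpha> + 1) (euler_op \<alpha> ?P)) d
       - n * d / (1 - d) * poly (euler_op \<alpha> ?P) d - poly ?P d powr p) \<longlongrightarrow>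
       poly (euler_op (\<alpha> + 1) (euler_op \<alpha> ?P)) 0
       - n * 0 / (1 - 0) * poly (euler_op \<alpha> ?P) 0 - poly ?P 0 powr p) (at_right 0)"
      using c by (intro tendsto_intros poly_tendsto_0) auto
    moreover have "poly (euler_op (\<alpha> + 1) (euler_op \<alpha> ?P)) 0
       - n * 0 / (1 - 0) * poly (euler_op \<alpha> ?P) 0 - poly ?P 0 powr p = 0"
      using cp by (simp add: euler_op_def pderiv_pCons algebra_simps)
    ultimately show ?case by (intro exI[of _ ?P]) (simp add: residual_def)
  next
    case (Suc k)
    then obtain P where P: "degree P \<le> k" "poly P 0 = c"
      "((\<lambda>d. residual n \<alpha> p P d / d ^ k) \<longlongrightarrow> 0) (at_right 0)" by auto
    have "poly_approx (k + 2) (residual n \<alpha> p P)" using P c by (intro residual_poly_approx) auto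
    then obtain l where l: "((\<lambda>d. residual n \<alpha> p P d / d ^ Suc k) \<longlongrightarrow> l) (at_right 0)"
      using poly_approx_next_order P(3) by blast
    define L where "L = (Suc k - \<alpha>) * (Suc k - \<alpha> - 1) - p * c powr (p - 1)"
    \<comment> \<open>no resonance: the roots of \<open>t (t - 1) = (\<alpha> + 2) (\<alpha> + 1)\<close> are \<open>\<alpha> + 2\<close> and \<open>- \<alpha> - 1\<close>, and
       \<open>t = Suc k - \<alpha>\<close> lies strictly between them\<close>
    have "(\<alpha> - Suc k) * (\<alpha> - Suc k + 1) \<le> \<alpha> * (\<alpha> + 1)"
      using Suc.prems by (intro mult_mono) auto
    hence "L \<le> \<alpha> * (\<alpha> + 1) - p * (\<alpha> * (\<alpha> + 1))" unfolding L_def c(2) by (simp add: algebra_simps)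
    also have "\<dots> = (1 - p) * (\<alpha> * (\<alpha> + 1))" by (simp add: algebra_simps)
    also have "\<dots> < 0" using \<alpha> p by (intro mult_neg_pos) auto
    finally have L: "L \<noteq> 0" by simp
    let ?P = "P + monom (- l / L) (Suc k)"
    have "((\<lambda>d. residual n \<alpha> p ?P d / d ^ Suc k) \<longlongrightarrow> l + (- l / L) * L) (at_right 0)"
      unfolding L_def by (rule residual_add_monom[OF P(2) c(1) _ l]) simp
    moreover have "degree ?P \<le> Suc k"
      using P(1) by (intro degree_add_le degree_monom_le) auto
    moreover have "poly ?P 0 = c" using P(2) by (simp add: poly_monom)
    ultimately show ?case using L by (intro exI[of _ ?P]) simp
  qed
  define k where "k = nat \<lfloor>\<alpha>\<rfloor>"
  have "real k \<le> \<alpha>" using \<alpha> by (simp add: k_def)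
  from step[OF this] obtain P where P: "degree P \<le> k" "poly P 0 = c"
    "((\<lambda>d. residual n \<alpha> p P d / d ^ k) \<longlongrightarrow> 0) (at_right 0)" by blast
  have "poly_approx (k + 2) (residual n \<alpha> p P)" using P c by (intro residual_poly_approx) auto
  then obtain l where l: "((\<lambda>d. residual n \<alpha> p P d / d ^ Suc k) \<longlongrightarrow> l) (at_right 0)"
    using poly_approx_next_order P(3) by blast
  have "eventually (\<lambda>d. \<bar>residual n \<alpha> p P d / d ^ Suc k\<bar> < \<bar>l\<bar> + 1) (at_right 0)"
    using tendsto_rabs[OF l] by (rule order_tendstoD) simp
  then obtain \<delta> where \<delta>: "\<delta> > 0"
    "\<And>d. 0 < d \<Longrightarrow> d < \<delta> \<Longrightarrow> \<bar>residual n \<alpha> p P d / d ^ Suc k\<bar> < \<bar>l\<bar> + 1"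
    unfolding eventually_at_right[OF zero_less_one] by blast
  have "\<bar>residual n \<alpha> p P d\<bar> \<le> (\<bar>l\<bar> + 1) * d ^ Suc k" if "0 < d" "d < \<delta>" for d
    using \<delta>(2)[OF that] that by (simp add: divide_less_eq abs_mult)
  thus ?thesis using that P c \<delta>(1) unfolding k_def by metis
qed

section \<open>Barriers near the boundary\<close>

lemma euler_op_derivative:
  assumes "d > 0"
  shows "((\<lambda>d. d powr (- \<alpha>) * poly P d) has_real_derivative
           d powr (- (\<alpha> + 1)) * poly (euler_op \<alpha> P) d) (at d)"
proof -
  have "((\<lambda>d. d powr (- \<alpha>) * poly P d) has_real_derivative
          (- \<alpha> * d powr (- \<alpha> - 1)) * poly P d + poly (pderiv P) d * d powr (- \<alpha>)) (at d)"
    using DERIV_mult[OF has_real_derivative_powr[OF assms, of "- \<alpha>"] poly_DERIV] by simp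
  moreover have "d powr (- \<alpha>) = d * d powr (- (\<alpha> + 1))"
    using powr_mult_base[of d "- (\<alpha> + 1)"] assms by simp
  moreover have "- \<alpha> - 1 = - (\<alpha> + 1)" by simp
  ultimately show ?thesis by (simp add: euler_op_def algebra_simps)
qed

definition expansion :: "real \<Rightarrow> real poly \<Rightarrow> real \<Rightarrow> real" where
  "expansion \<alpha> P d = d powr (- \<alpha>) * poly P d"

definition barrier :: "real \<Rightarrow> real poly \<Rightarrow> real \<Rightarrow> real \<Rightarrow> real \<Rightarrow> real" where
  "barrier \<alpha> P \<gamma> C r = expansion \<alpha> P (1 - r) + C * (1 - r) powr \<gamma>"

definition barrier' :: "real \<Rightarrow> real poly \<Rightarrow> real \<Rightarrow> real \<Rightarrow> real \<Rightarrow> real" where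
  "barrier' \<alpha> P \<gamma> C r = - expansion (\<alpha> + 1) (euler_op \<alpha> P) (1 - r) - C * \<gamma> * (1 - r) powr (\<gamma> - 1)"

definition barrier'' :: "real \<Rightarrow> real poly \<Rightarrow> real \<Rightarrow> real \<Rightarrow> real \<Rightarrow> real" where
  "barrier'' \<alpha> P \<gamma> C r = expansion (\<alpha> + 2) (euler_op (\<alpha> + 1) (euler_op \<alpha> P)) (1 - r)
     + C * \<gamma> * (\<gamma> - 1) * (1 - r) powr (\<gamma> - 2)"

lemma barrier_derivatives:
  assumes "r < 1"
  shows "(barrier \<alpha> P \<gamma> C has_real_derivative barrier' \<alpha> P \<gamma> C r) (at r)"
    and "(barrier' \<alpha> P \<gamma> C has_real_derivative barrier'' \<alpha> P \<gamma> C r) (at r)"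
proof -
  have flip: "((\<lambda>r. f (1 - r)) has_real_derivative - D) (at r)"
    if f: "(f has_real_derivative D) (at (1 - r))" for f D
  proof -
    have "((\<lambda>r. 1 - r) has_real_derivative - 1) (at r)" by (auto intro!: derivative_eq_intros)
    from DERIV_chain2[where g = "\<lambda>r. 1 - r", OF f this] show ?thesis by simp
  qed
  have e: "((\<lambda>r. expansion \<beta> Q (1 - r)) has_real_derivative - expansion (\<beta> + 1) (euler_op \<beta> Q) (1 - r)) (at r)" for \<beta> Q
    unfolding expansion_def by (intro flip euler_op_derivative) (use assms in simp)
  have g: "((\<lambda>r. (1 - r) powr \<beta>) has_real_derivative - (\<beta> * (1 - r) powr (\<beta> - 1))) (at r)" for \<beta>
    by (intro flip has_real_derivative_powr) (use assms in simp)
  show "(barrier \<alpha> P \<gamma> C has_real_derivative barrier' \<alpha> P \<gamma> C r) (at r)"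
    unfolding barrier_def[abs_def] barrier'_def
    by (rule DERIV_cong[OF DERIV_add[OF e DERIV_cmult[OF g]]]) simp
  have "\<alpha> + 1 + 1 = \<alpha> + 2" "\<gamma> - 1 - 1 = \<gamma> - 2" by simp_all
  thus "(barrier' \<alpha> P \<gamma> C has_real_derivative barrier'' \<alpha> P \<gamma> C r) (at r)"
    unfolding barrier'_def[abs_def] barrier''_def
    by (intro DERIV_cong[OF DERIV_diff[OF DERIV_minus[OF e] DERIV_cmult[OF g]]]) (simp add: add.commute)
qed

text \<open>The drift \<open>n / r\<close> with \<open>r = 1 - d\<close> is the source of the factor \<open>n d / (1 - d)\<close> in the residual.\<close>

lemma barrier_operator:
  assumes d: "0 < d" "d < 1" and P: "poly P d > 0" and p\<alpha>: "p * \<alpha> = \<alpha> + 2"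
  shows "barrier'' \<alpha> P \<gamma> C (1 - d) + n / (1 - d) * barrier' \<alpha> P \<gamma> C (1 - d) =
     expansion \<alpha> P d powr p + d powr (- (\<alpha> + 2)) * residual n \<alpha> p P d
     + C * (\<gamma> * (\<gamma> - 1) * d powr (\<gamma> - 2) - n / (1 - d) * \<gamma> * d powr (\<gamma> - 1))"
proof -
  have "expansion \<alpha> P d powr p = d powr (- (\<alpha> + 2)) * poly P d powr p"
    using P p\<alpha> by (simp add: expansion_def powr_mult powr_powr mult.commute)
  moreover have "d powr (- (\<alpha> + 1)) = d * d powr (- (\<alpha> + 2))"
  proof -
    have "d * d powr (- (\<alpha> + 2)) = d powr (1 + - (\<alpha> + 2))"
      by (rule powr_mult_base) (use d in simp)
    also have "1 + - (\<alpha> + 2) = - (\<alpha> + 1)" by simp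
    finally show ?thesis by (rule sym)
  qed
  ultimately show ?thesis
    unfolding barrier''_def barrier'_def residual_def
    by (simp add: expansion_def algebra_simps)
qed

text \<open>The layer \<open>0 < d \<le> \<delta>\<close> on which the expansion controls the equation. No solution enters,
so that \<open>K\<close>, \<open>\<kappa>\<close> and \<open>\<delta>\<close> are available before one is chosen.\<close>

locale boundary_expansion =
  fixes n p \<alpha> \<gamma> :: real and P :: "real poly" and K \<kappa> \<delta> :: real
  assumes n: "n \<ge> 0" and p: "p > 1" and \<alpha>: "\<alpha> > 0" and p\<alpha>: "p * \<alpha> = \<alpha> + 2"
    and \<gamma>: "0 < \<gamma>" "\<gamma> \<le> 1" and \<kappa>: "\<kappa> > 0" and \<delta>: "0 < \<delta>" "\<delta> < 1"
    and P0: "poly P 0 > 0"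
    and P: "\<And>d. 0 < d \<Longrightarrow> d \<le> \<delta> \<Longrightarrow> poly P d > 0"
      "\<And>d. 0 < d \<Longrightarrow> d \<le> \<delta> \<Longrightarrow> poly P d powr (p - 1) \<ge> \<kappa>"
    and resid: "\<And>d. 0 < d \<Longrightarrow> d \<le> \<delta> \<Longrightarrow> \<bar>residual n \<alpha> p P d\<bar> \<le> K * d powr (\<gamma> + \<alpha>)"
begin

lemma expansion_pos: "0 < d \<Longrightarrow> d \<le> \<delta> \<Longrightarrow> expansion \<alpha> P d > 0"
  using P(1) by (simp add: expansion_def)

lemma residual_bound:
  assumes "0 < d" "d \<le> \<delta>"
  shows "\<bar>d powr (- (\<alpha> + 2)) * residual n \<alpha> p P d\<bar> \<le> K * d powr (\<gamma> - 2)"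
proof -
  have "\<bar>d powr (- (\<alpha> + 2)) * residual n \<alpha> p P d\<bar> \<le> d powr (- (\<alpha> + 2)) * (K * d powr (\<gamma> + \<alpha>))"
    unfolding abs_mult using resid[OF assms] by (intro mult_mono) auto
  also have "\<dots> = K * (d powr (- (\<alpha> + 2)) * d powr (\<gamma> + \<alpha>))" by simp
  also have "d powr (- (\<alpha> + 2)) * d powr (\<gamma> + \<alpha>) = d powr (\<gamma> - 2)"
    by (simp flip: powr_add)
  finally show ?thesis .
qed

text \<open>Since \<open>A(d)\<^sup>p\<^sup>-\<^sup>1 = P(d)\<^sup>p\<^sup>-\<^sup>1 / d\<^sup>2\<close> for the expansion \<open>A\<close>, the nonlinearity reacts to the correction
\<open>C d powr \<gamma>\<close> at the order \<open>d powr (\<gamma> - 2)\<close> of the residual term.\<close>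

lemma expansion_power_gain:
  assumes "0 < d" "d \<le> \<delta>"
  shows "\<kappa> * d powr (\<gamma> - 2) \<le> expansion \<alpha> P d powr (p - 1) * d powr \<gamma>"
proof -
  have "- \<alpha> * (p - 1) = - 2" using p\<alpha> by (simp add: algebra_simps)
  hence "expansion \<alpha> P d powr (p - 1) = d powr (- 2) * poly P d powr (p - 1)"
    using P(1)[OF assms] by (simp add: expansion_def powr_mult powr_powr)
  hence "expansion \<alpha> P d powr (p - 1) * d powr \<gamma> = poly P d powr (p - 1) * (d powr (- 2) * d powr \<gamma>)"
    by simp
  also have "d powr (- 2) * d powr \<gamma> = d powr (\<gamma> - 2)" by (simp flip: powr_add)
  finally show ?thesis using P(2)[OF assms] by (simp add: mult_right_mono)
qed

text \<open>For \<open>0 < \<gamma> \<le> 1\<close> the correction is concave in \<open>r\<close> and decreasing, so the linear part of the operator helps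
both the supersolution and, with the opposite sign of \<open>C\<close>, the subsolution.\<close>

lemma correction_sign:
  assumes "0 < d" "d \<le> \<delta>"
  shows "\<gamma> * (\<gamma> - 1) * d powr (\<gamma> - 2) - n / (1 - d) * \<gamma> * d powr (\<gamma> - 1) \<le> 0"
proof -
  have "\<gamma> * (\<gamma> - 1) * d powr (\<gamma> - 2) \<le> 0"
    using \<gamma> by (intro mult_nonpos_nonneg mult_nonneg_nonpos) auto
  moreover have "n / (1 - d) * \<gamma> * d powr (\<gamma> - 1) \<ge> 0"
    using n \<gamma> assms \<delta> by simp
  ultimately show ?thesis by linarith
qed

lemma powr_split: "x > 0 \<Longrightarrow> x powr p = x powr (p - 1) * x"
  using powr_mult_base[of x "p - 1"] by (simp add: mult.commute)

text \<open>Let \<open>A\<close> be the expansion and \<open>w \<ge> A > 0\<close> the barrier. Then \<open>w\<^sup>p \<ge> A\<^sup>p\<^sup>-\<^sup>1 w = A\<^sup>p + A\<^sup>p\<^sup>-\<^sup>1 C d powr \<gamma>\<close>. The gain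
is linear in \<open>C\<close> and beats the residual on the whole layer, however large \<open>C\<close> is.\<close>

lemma barrier_super:
  assumes d: "0 < d" "d \<le> \<delta>" and C: "0 \<le> C" "K \<le> C * \<kappa>"
  shows "barrier'' \<alpha> P \<gamma> C (1 - d) + n / (1 - d) * barrier' \<alpha> P \<gamma> C (1 - d) \<le> barrier \<alpha> P \<gamma> C (1 - d) powr p"
proof -
  let ?A = "expansion \<alpha> P d"
  have A: "?A > 0" using expansion_pos d by simp
  have "barrier'' \<alpha> P \<gamma> C (1 - d) + n / (1 - d) * barrier' \<alpha> P \<gamma> C (1 - d)
      \<le> ?A powr p + K * d powr (\<gamma> - 2)"
    using barrier_operator[OF d(1) _ P(1)[OF d] p\<alpha>, of \<gamma> C n] d \<delta> residual_bound[OF d]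
      mult_nonneg_nonpos[OF C(1) correction_sign[OF d]] by linarith
  also have "\<dots> \<le> ?A powr p + (C * \<kappa>) * d powr (\<gamma> - 2)"
    using C by (intro add_left_mono mult_right_mono) auto
  also have "\<dots> \<le> ?A powr p + C * (?A powr (p - 1) * d powr \<gamma>)"
    using mult_left_mono[OF expansion_power_gain[OF d] C(1)] by (simp add: mult.assoc)
  also have "\<dots> = ?A powr (p - 1) * barrier \<alpha> P \<gamma> C (1 - d)"
    using powr_split[OF A] by (simp add: barrier_def algebra_simps)
  also have "\<dots> \<le> barrier \<alpha> P \<gamma> C (1 - d) powr (p - 1) * barrier \<alpha> P \<gamma> C (1 - d)"
    using A C p by (intro mult_right_mono powr_mono2) (auto simp: barrier_def)
  also have "\<dots> = barrier \<alpha> P \<gamma> C (1 - d) powr p"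
    using A C by (intro powr_split[symmetric]) (auto simp: barrier_def add_pos_nonneg)
  finally show ?thesis .
qed

text \<open>The mirror image: \<open>0 < w \<le> A\<close> gives \<open>w\<^sup>p \<le> A\<^sup>p\<^sup>-\<^sup>1 w\<close>. Convexity of the power would point the wrong way
here, but this cruder estimate suffices and is valid wherever \<open>w\<close> is positive, again for all large \<open>C\<close>.\<close>

lemma barrier_sub:
  assumes d: "0 < d" "d \<le> \<delta>" and C: "0 \<le> C" "K \<le> C * \<kappa>"
    and pos: "barrier \<alpha> P \<gamma> (- C) (1 - d) > 0"
  shows "barrier \<alpha> P \<gamma> (- C) (1 - d) powr p \<le>
     barrier'' \<alpha> P \<gamma> (- C) (1 - d) + n / (1 - d) * barrier' \<alpha> P \<gamma> (- C) (1 - d)"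
proof -
  let ?A = "expansion \<alpha> P d" and ?w = "barrier \<alpha> P \<gamma> (- C) (1 - d)"
  have A: "?A > 0" using expansion_pos d by simp
  have "?w powr p = ?w powr (p - 1) * ?w" using pos by (rule powr_split)
  also have "\<dots> \<le> ?A powr (p - 1) * ?w"
    using pos C p by (intro mult_right_mono powr_mono2) (auto simp: barrier_def)
  also have "\<dots> = ?A powr p - C * (?A powr (p - 1) * d powr \<gamma>)"
    using powr_split[OF A] by (simp add: barrier_def algebra_simps)
  also have "\<dots> \<le> ?A powr p - (C * \<kappa>) * d powr (\<gamma> - 2)"
    using mult_left_mono[OF expansion_power_gain[OF d] C(1)] by (simp add: mult.assoc)
  also have "\<dots> \<le> ?A powr p - K * d powr (\<gamma> - 2)"
    using C by (intro diff_left_mono mult_right_mono) auto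
  also have "\<dots> \<le> barrier'' \<alpha> P \<gamma> (- C) (1 - d) + n / (1 - d) * barrier' \<alpha> P \<gamma> (- C) (1 - d)"
    using barrier_operator[OF d(1) _ P(1)[OF d] p\<alpha>, of \<gamma> "- C" n] d \<delta> residual_bound[OF d]
      mult_nonneg_nonpos[OF C(1) correction_sign[OF d]] by linarith
  finally show ?thesis .
qed

lemma barrier_blowup:
  assumes "C \<ge> 0"
  shows "filterlim (barrier \<alpha> P \<gamma> C) at_top (at_left 1)"
proof -
  have f: "filterlim (\<lambda>r::real. 1 - r) (at_right 0) (at_left 1)"
    unfolding filterlim_at by (auto intro!: tendsto_eq_intros simp: eventually_at_filter)
  have "filterlim (\<lambda>d. poly P d * d powr (- \<alpha>)) at_top (at_right 0)"
    by (rule filterlim_tendsto_pos_mult_at_top[OF poly_tendsto_0 P0 powr_neg_blowup[OF \<alpha>]])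
  from filterlim_compose[OF this f]
  have "filterlim (\<lambda>r. expansion \<alpha> P (1 - r)) at_top (at_left 1)"
    by (simp add: expansion_def mult.commute)
  thus ?thesis
    by (rule filterlim_at_top_mono) (use assms in \<open>auto simp: barrier_def\<close>)
qed

end

lemma radial_large_solution_ode:
  assumes "radial_large_solution N p R u h g" "0 < r" "r < R"
  shows "(u has_real_derivative r * h r) (at r)"
    "((\<lambda>r. r * h r) has_real_derivative u r powr p - (real N - 1) * h r) (at r)"
proof -
  have D: "(u has_real_derivative r * h r) (at r)" "(h has_real_derivative (g r - N * h r) / r) (at r)"
    "g r = u r powr p"
    using assms by (auto simp: radial_large_solution_def radial_profile_def)
  show "(u has_real_derivative r * h r) (at r)" by (rule D)
  show "((\<lambda>r. r * h r) has_real_derivative u r powr p - (real N - 1) * h r) (at r)"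
    by (rule DERIV_cong[OF DERIV_mult'[OF DERIV_ident D(2)]])
       (use assms D(3) in \<open>simp add: field_simps\<close>)
qed

lemma radial_large_solution_isCont:
  "radial_large_solution N p R u h g \<Longrightarrow> 0 < r \<Longrightarrow> r < R \<Longrightarrow> isCont u r"
  using radial_large_solution_ode(1) DERIV_isCont by blast

lemma isCont_eventually_le:
  fixes f g :: "real \<Rightarrow> real"
  assumes "isCont f a" "isCont g a" "f a < g a"
  shows "eventually (\<lambda>x. f x \<le> g x) (at a within S)"
proof -
  have "((\<lambda>x. g x - f x) \<longlongrightarrow> g a - f a) (at a within S)"
    using assms(1,2) unfolding isCont_def by (intro tendsto_diff) (auto intro: tendsto_within_subset)
  from order_tendstoD(1)[OF this, of 0] have "eventually (\<lambda>x. 0 < g x - f x) (at a within S)"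
    using assms(3) by simp
  thus ?thesis by eventually_elim simp
qed

context boundary_expansion
begin

text \<open>A solution \<open>v\<close> that is finite at \<open>r = 1\<close> lies below the upper barrier, which is infinite there.\<close>

lemma barrier_comparison_below:
  assumes v: "radial_large_solution N p R v k q" and N: "n = real N - 1"
    and R: "1 < R" and C: "0 \<le> C" "K \<le> C * \<kappa>"
    and start: "v (1 - \<delta>) < barrier \<alpha> P \<gamma> C (1 - \<delta>)" and r: "1 - \<delta> < r" "r < 1"
  shows "v r \<le> barrier \<alpha> P \<gamma> C r"
proof (rule radial_comparison_principle[where a = "1 - \<delta>" and b = 1 and u = v and c = "\<lambda>r. n / r"
    and v = "barrier \<alpha> P \<gamma> C" and v' = "barrier' \<alpha> P \<gamma> C" and v'' = "barrier'' \<alpha> P \<gamma> C"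
    and u' = "\<lambda>r. r * k r" and u'' = "\<lambda>r. v r powr p - n * k r"])
  fix r assume r: "1 - \<delta> < r" "r < 1"
  hence r': "0 < r" "r < R" using \<delta> R by auto
  show "(v has_real_derivative r * k r) (at r)"
    "((\<lambda>r. r * k r) has_real_derivative v r powr p - n * k r) (at r)"
    using radial_large_solution_ode[OF v r'] N by simp_all
  show "(barrier \<alpha> P \<gamma> C has_real_derivative barrier' \<alpha> P \<gamma> C r) (at r)"
    "(barrier' \<alpha> P \<gamma> C has_real_derivative barrier'' \<alpha> P \<gamma> C r) (at r)"
    using barrier_derivatives r by blast+
  assume less: "barrier \<alpha> P \<gamma> C r < v r"
  have d: "0 < 1 - r" "1 - r \<le> \<delta>" using r by auto
  have "barrier \<alpha> P \<gamma> C r > 0"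
    using expansion_pos[OF d] C by (simp add: barrier_def add_pos_nonneg)
  hence "barrier \<alpha> P \<gamma> C r powr p < v r powr p" using less p by (intro powr_less_mono2) auto
  moreover have "v r powr p - n * k r + n / r * (r * k r) = v r powr p" using r' by simp
  ultimately show "barrier'' \<alpha> P \<gamma> C r + n / r * barrier' \<alpha> P \<gamma> C r < v r powr p - n * k r + n / r * (r * k r)"
    using barrier_super[OF d C] by simp
next
  show "eventually (\<lambda>r. v r \<le> barrier \<alpha> P \<gamma> C r) (at_right (1 - \<delta>))"
    by (rule isCont_eventually_le[where f = v and g = "barrier \<alpha> P \<gamma> C" and a = "1 - \<delta>"])
       (use start v R \<delta> radial_large_solution_isCont DERIV_isCont[OF barrier_derivatives(1)] in auto)
  have "isCont v 1" using radial_large_solution_isCont[OF v] R by simp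
  hence "eventually (\<lambda>r. v r < v 1 + 1) (at_left 1)"
    unfolding isCont_def by (intro order_tendstoD(2)[of v "v 1"]) (auto intro: tendsto_within_subset)
  moreover have "eventually (\<lambda>r. v 1 + 1 \<le> barrier \<alpha> P \<gamma> C r) (at_left 1)"
    using barrier_blowup[OF C(1)] by (auto simp: filterlim_at_top)
  ultimately show "eventually (\<lambda>r. v r \<le> barrier \<alpha> P \<gamma> C r) (at_left 1)"
    by eventually_elim linarith
qed (use r in auto)

text \<open>A solution \<open>v\<close> that blows up at \<open>R < 1\<close>, where the lower barrier is still finite, lies above it. The
comparison only involves points where the barrier exceeds \<open>v\<close>, hence is positive.\<close>

lemma barrier_comparison_above:
  assumes v: "radial_large_solution N p R v k q" and N: "n = real N - 1"
    and R: "1 - \<delta> < R" "R < 1" and C: "0 \<le> C" "K \<le> C * \<kappa>"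
    and start: "barrier \<alpha> P \<gamma> (- C) (1 - \<delta>) \<le> 0" and r: "1 - \<delta> < r" "r < R"
  shows "barrier \<alpha> P \<gamma> (- C) r \<le> v r"
proof (rule radial_comparison_principle[where a = "1 - \<delta>" and b = R and v = v and c = "\<lambda>r. n / r"
    and u = "barrier \<alpha> P \<gamma> (- C)" and u' = "barrier' \<alpha> P \<gamma> (- C)" and u'' = "barrier'' \<alpha> P \<gamma> (- C)"
    and v' = "\<lambda>r. r * k r" and v'' = "\<lambda>r. v r powr p - n * k r"])
  fix r assume r: "1 - \<delta> < r" "r < R"
  hence r': "0 < r" "r < 1" using \<delta> R by auto
  show "(v has_real_derivative r * k r) (at r)"
    "((\<lambda>r. r * k r) has_real_derivative v r powr p - n * k r) (at r)"
    using radial_large_solution_ode[OF v r'(1) r(2)] N by simp_all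
  show "(barrier \<alpha> P \<gamma> (- C) has_real_derivative barrier' \<alpha> P \<gamma> (- C) r) (at r)"
    "(barrier' \<alpha> P \<gamma> (- C) has_real_derivative barrier'' \<alpha> P \<gamma> (- C) r) (at r)"
    using barrier_derivatives r' by blast+
  assume less: "v r < barrier \<alpha> P \<gamma> (- C) r"
  have d: "0 < 1 - r" "1 - r \<le> \<delta>" using r r' by auto
  have vpos: "v r > 0" using v r r' by (simp add: radial_large_solution_def)
  hence "v r powr p < barrier \<alpha> P \<gamma> (- C) r powr p" using less p by (intro powr_less_mono2) auto
  moreover have "v r powr p - n * k r + n / r * (r * k r) = v r powr p" using r' by simp
  ultimately show "v r powr p - n * k r + n / r * (r * k r) < barrier'' \<alpha> P \<gamma> (- C) r + n / r * barrier' \<alpha> P \<gamma> (- C) r"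
    using barrier_sub[OF d C] less vpos by simp
next
  have "v (1 - \<delta>) > 0" using v R \<delta> by (simp add: radial_large_solution_def)
  hence "barrier \<alpha> P \<gamma> (- C) (1 - \<delta>) < v (1 - \<delta>)" using start by linarith
  thus "eventually (\<lambda>r. barrier \<alpha> P \<gamma> (- C) r \<le> v r) (at_right (1 - \<delta>))"
    using v R \<delta> radial_large_solution_isCont DERIV_isCont[OF barrier_derivatives(1)]
    by (intro isCont_eventually_le) auto
  let ?B = "barrier \<alpha> P \<gamma> (- C)"
  have "isCont ?B R" using DERIV_isCont[OF barrier_derivatives(1)] R by simp
  hence "eventually (\<lambda>r. ?B r < ?B R + 1) (at_left R)"
    unfolding isCont_def by (intro order_tendstoD(2)[of ?B "?B R"]) (auto intro: tendsto_within_subset)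
  moreover have "eventually (\<lambda>r. ?B R + 1 \<le> v r) (at_left R)"
    using v by (auto simp: filterlim_at_top radial_large_solution_def)
  ultimately show "eventually (\<lambda>r. ?B r \<le> v r) (at_left R)"
    by eventually_elim linarith
qed (use r in auto)

text \<open>The comparisons are applied to the rescalings \<open>u\<^sub>l\<close> with one constant \<open>C\<close> for all \<open>l\<close>.\<close>

lemma large_solution_expansion:
  assumes u: "radial_large_solution N p 1 u h g" and N: "n = real N - 1"
  shows "((\<lambda>r. u r - expansion \<alpha> P (1 - r)) \<longlongrightarrow> 0) (at_left 1)"
proof -
  have \<alpha>_eq: "\<alpha> = 2 / (p - 1)" using p\<alpha> p by (simp add: field_simps)
  let ?u = "\<lambda>l r. l powr (2 / (p - 1)) * u (l * r)"
  let ?h = "\<lambda>l r. l powr (2 / (p - 1)) * l\<^sup>2 * h (l * r)"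
  let ?g = "\<lambda>l r. l powr (2 / (p - 1)) * l\<^sup>2 * g (l * r)"
  have U: "radial_large_solution N p (1 / l) (?u l) (?h l) (?g l)" if "l > 0" for l
    using radial_large_solution_rescale[OF u that p] .
  have ubd: "u r > 0" if "0 \<le> r" "r < 1" for r
    using u that by (simp add: radial_large_solution_def)
  have umono: "u r \<le> u s" if "0 \<le> r" "r \<le> s" "s < 1" for r s
    using u that mono_onD[of "{0..<1}" u r s] by (simp add: radial_large_solution_def)
  \<comment> \<open>at the inner edge, where the correction is \<open>C \<delta> powr \<gamma>\<close>, the upper barrier must exceed \<open>u\<close> and the
     lower one must not exceed 0\<close>
  define M where "M = max (u (1 - \<delta>)) (expansion \<alpha> P \<delta>) + 1"
  have M: "u (1 - \<delta>) < M" "expansion \<alpha> P \<delta> < M" "M > 0"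
    using ubd[of "1 - \<delta>"] \<delta> by (auto simp: M_def)
  define C where "C = max (M / \<delta> powr \<gamma>) (K / \<kappa>)"
  have C\<delta>: "M \<le> C * \<delta> powr \<gamma>"
    using \<delta> by (simp add: C_def flip: pos_divide_le_eq)
  have C: "0 \<le> C" "K \<le> C * \<kappa>"
    using \<delta> \<kappa> M(3) by (auto simp: C_def le_max_iff_disj simp flip: pos_divide_le_eq)
  have upper: "u r \<le> barrier \<alpha> P \<gamma> C r" if r: "1 - \<delta> < r" "r < 1" for r
  proof (rule tendsto_upperbound)
    show "((\<lambda>l. ?u l r) \<longlongrightarrow> u r) (at_left 1)"
      using rescaling_tendsto[OF u] r \<delta> by simp
    show "eventually (\<lambda>l. ?u l r \<le> barrier \<alpha> P \<gamma> C r) (at_left 1)"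
      using eventually_at_left_real[of 0 1, OF zero_less_one]
    proof eventually_elim
      case (elim l)
      have l: "0 < l" "l < 1" using elim by auto
      \<comment> \<open>for \<open>l < 1\<close> rescaling decreases the increasing function \<open>u\<close>, so \<open>C\<close> need not depend on \<open>l\<close>\<close>
      have "l powr (2 / (p - 1)) \<le> 1" using l p by (intro powr_le1) auto
      moreover have "u (l * (1 - \<delta>)) \<le> u (1 - \<delta>)"
        using l \<delta> by (intro umono) (auto simp: mult_le_cancel_right1)
      moreover have "0 < u (l * (1 - \<delta>))"
        using l \<delta> by (intro ubd) (auto intro: le_less_trans[OF mult_right_le_one_le])
      ultimately have "?u l (1 - \<delta>) \<le> 1 * u (1 - \<delta>)" by (intro mult_mono) auto
      also have "\<dots> < M" using M(1) by simp
      also have "\<dots> \<le> barrier \<alpha> P \<gamma> C (1 - \<delta>)"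
        using C\<delta> expansion_pos[of \<delta>] \<delta> by (simp add: barrier_def)
      finally show ?case
        by (intro barrier_comparison_below[OF U[OF l(1)] N _ C _ r]) (use l in simp_all)
    qed
  qed simp
  have lower: "barrier \<alpha> P \<gamma> (- C) r \<le> u r" if r: "1 - \<delta> < r" "r < 1" for r
  proof (rule tendsto_lowerbound)
    show "((\<lambda>l. ?u l r) \<longlongrightarrow> u r) (at_right 1)"
      using rescaling_tendsto[OF u] r \<delta> by simp
    have start: "barrier \<alpha> P \<gamma> (- C) (1 - \<delta>) \<le> 0"
      using C\<delta> M(2) by (simp add: barrier_def)
    have "1 < 1 / r" using r \<delta> by (simp add: less_divide_eq)
    from eventually_at_right_real[OF this]
    show "eventually (\<lambda>l. barrier \<alpha> P \<gamma> (- C) r \<le> ?u l r) (at_right 1)"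
    proof eventually_elim
      case (elim l)
      have l: "1 < l" "r < 1 / l" using elim r \<delta> by (auto simp: field_simps)
      show ?case
        by (rule barrier_comparison_above[OF U N _ _ C start r(1) l(2)])
           (use l r in \<open>auto simp: divide_less_eq\<close>)
    qed
  qed simp
  have lim: "((\<lambda>r. C * (1 - r) powr \<gamma>) \<longlongrightarrow> 0) (at_left 1)"
  proof -
    have "((\<lambda>r::real. (1 - r) powr \<gamma>) \<longlongrightarrow> 0 powr \<gamma>) (at_left 1)"
    proof (rule tendsto_powr')
      show "((\<lambda>r::real. 1 - r) \<longlongrightarrow> 0) (at_left 1)" by (auto intro!: tendsto_eq_intros)
    qed (use \<gamma> in \<open>auto simp: eventually_at_filter\<close>)
    thus ?thesis using \<gamma> tendsto_mult_right_zero by auto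
  qed
  show ?thesis
  proof (rule Lim_null_comparison[OF _ lim])
    have "1 - \<delta> < 1" using \<delta>(1) by simp
    from eventually_at_left_real[OF this]
    show "eventually (\<lambda>r. norm (u r - expansion \<alpha> P (1 - r)) \<le> C * (1 - r) powr \<gamma>) (at_left 1)"
    proof eventually_elim
      case (elim r)
      thus ?case using upper[of r] lower[of r] by (auto simp: barrier_def abs_le_iff)
    qed
  qed
qed

end

text \<open>The coefficients are those of the formal expansion, chosen before the solution.\<close>

lemma radial_large_solution_expansion:
  assumes p: "p > 1" and N: "N > 0"
  shows "\<exists>a. \<forall>u h g. radial_large_solution N p 1 u h g \<longrightarrow>
     ((\<lambda>r. u r - (1 - r) powr (- (2 / (p - 1))) * (\<Sum>k = 0..nat \<lfloor>2 / (p - 1)\<rfloor>. a k * (1 - r) ^ k))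
        \<longlongrightarrow> 0) (at_left 1)"
proof -
  define \<alpha> where "\<alpha> = 2 / (p - 1)"
  define n where "n = real N - 1"
  define m where "m = nat \<lfloor>\<alpha>\<rfloor>"
  \<comment> \<open>the first exponent beyond the expansion\<close>
  define \<gamma> where "\<gamma> = real (Suc m) - \<alpha>"
  have \<alpha>: "\<alpha> > 0" "p * \<alpha> = \<alpha> + 2" using p by (auto simp: \<alpha>_def field_simps)
  have \<gamma>: "0 < \<gamma>" "\<gamma> \<le> 1" using \<alpha> unfolding \<gamma>_def m_def by linarith+
  have n: "n \<ge> 0" using N by (simp add: n_def)
  obtain P K \<delta>1 where Pf: "degree P \<le> m" "poly P 0 > 0" "poly P 0 powr (p - 1) = \<alpha> * (\<alpha> + 1)"
    and \<delta>1: "\<delta>1 > 0" "\<And>d. 0 < d \<Longrightarrow> d < \<delta>1 \<Longrightarrow> \<bar>residual n \<alpha> p P d\<bar> \<le> K * d ^ Suc m"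
    by (rule formal_expansion[OF \<alpha>, of n, folded m_def]) (rule that)
  \<comment> \<open>any positive number below the limit \<open>\<alpha> (\<alpha> + 1)\<close> of \<open>P(d)\<^sup>p\<^sup>-\<^sup>1\<close>\<close>
  define \<kappa> where "\<kappa> = \<alpha> * (\<alpha> + 1) / 2"
  have \<kappa>: "\<kappa> > 0" "\<kappa> < \<alpha> * (\<alpha> + 1)" using \<alpha>(1) by (auto simp: \<kappa>_def)
  have "((\<lambda>d. poly P d powr (p - 1)) \<longlongrightarrow> poly P 0 powr (p - 1)) (at_right 0)"
    using Pf(2) by (intro tendsto_intros poly_tendsto_0) auto
  hence "eventually (\<lambda>d. \<kappa> < poly P d powr (p - 1)) (at_right 0)"
    using Pf(3) \<kappa>(2) by (intro order_tendstoD(1)) auto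
  moreover have "eventually (\<lambda>d. 0 < poly P d) (at_right 0)"
    using poly_tendsto_0 Pf(2) by (rule order_tendstoD)
  ultimately have "eventually (\<lambda>d. \<kappa> < poly P d powr (p - 1) \<and> 0 < poly P d) (at_right 0)"
    by eventually_elim blast
  then obtain \<delta>2 where \<delta>2: "\<delta>2 > 0" "\<And>d. 0 < d \<Longrightarrow> d < \<delta>2 \<Longrightarrow> \<kappa> < poly P d powr (p - 1) \<and> 0 < poly P d"
    unfolding eventually_at_right[OF zero_less_one] by blast
  define \<delta> where "\<delta> = min (min \<delta>1 \<delta>2) 1 / 2"
  have \<delta>: "0 < \<delta>" "\<delta> < 1" "\<delta> < \<delta>1" "\<delta> < \<delta>2" using \<delta>1(1) \<delta>2(1) by (auto simp: \<delta>_def min_def)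
  interpret boundary_expansion n p \<alpha> \<gamma> P K \<kappa> \<delta>
  proof unfold_locales
    fix d assume d: "0 < d" "d \<le> \<delta>"
    show "poly P d > 0" "\<kappa> \<le> poly P d powr (p - 1)" using \<delta>2(2)[of d] d \<delta> by auto
    have "d powr (\<gamma> + \<alpha>) = d ^ Suc m"
      using d powr_realpow[of d "Suc m"] by (simp add: \<gamma>_def)
    thus "\<bar>residual n \<alpha> p P d\<bar> \<le> K * d powr (\<gamma> + \<alpha>)" using \<delta>1(2)[of d] d \<delta> by simp
  qed (use n p \<alpha> \<gamma> \<kappa> \<delta> Pf in auto)
  have "expansion \<alpha> P d = d powr (- \<alpha>) * (\<Sum>k = 0..m. coeff P k * d ^ k)" for d
  proof -
    have "poly P d = (\<Sum>k = 0..m. coeff P k * d ^ k)"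
      unfolding poly_altdef using Pf(1) by (intro sum.mono_neutral_left) (auto simp: coeff_eq_0)
    thus ?thesis by (simp add: expansion_def)
  qed
  thus ?thesis using large_solution_expansion unfolding n_def \<alpha>_def[symmetric] m_def[symmetric]
    by (intro exI[of _ "coeff P"]) simp
qed

section \<open>Existence, uniqueness and boundary behaviour\<close>

theorem proposition1p14:
  fixes p :: real
  assumes "p > 1"
  shows
    "(\<exists>u :: real ^ 'n \<Rightarrow> real. positive_large_solution (\<lambda>t. t powr p) u \<and>
        (\<forall>v. positive_large_solution (\<lambda>t. t powr p) v \<longrightarrow> (\<forall>x\<in>ball 0 1. v x = u x))) \<and>
     (\<exists>a :: nat \<Rightarrow> real. \<forall>u :: real ^ 'n \<Rightarrow> real. positive_large_solution (\<lambda>t. t powr p) u \<longrightarrow>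
        (\<lambda>x. u x - (1 - norm x) powr (- (2 / (p - 1))) *
               (\<Sum>k = 0..nat \<lfloor>2 / (p - 1)\<rfloor>. a k * (1 - norm x) ^ k))
          \<in> o[filtercomap norm (at_left 1)](\<lambda>_. 1))"
proof (rule conjI)
  obtain U h g where U: "radial_large_solution DIM(real ^ 'n) p 1 U h g"
    using radial_large_solution_unit[OF assms] by blast
  show "\<exists>u :: real ^ 'n \<Rightarrow> real. positive_large_solution (\<lambda>t. t powr p) u \<and>
        (\<forall>v. positive_large_solution (\<lambda>t. t powr p) v \<longrightarrow> (\<forall>x\<in>ball 0 1. v x = u x))"
    using radial_large_solution_positive_large_solution[OF U]
      positive_large_solution_radial[OF assms U]
    by (intro exI[of _ "\<lambda>x. U (norm x)"]) blast
  obtain a where a: "((\<lambda>r. U r - (1 - r) powr (- (2 / (p - 1))) *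
      (\<Sum>k = 0..nat \<lfloor>2 / (p - 1)\<rfloor>. a k * (1 - r) ^ k)) \<longlongrightarrow> 0) (at_left 1)"
    using radial_large_solution_expansion[OF assms DIM_positive[where 'a = "real ^ 'n"]] U by blast
  show "\<exists>a :: nat \<Rightarrow> real. \<forall>u :: real ^ 'n \<Rightarrow> real. positive_large_solution (\<lambda>t. t powr p) u \<longrightarrow>
        (\<lambda>x. u x - (1 - norm x) powr (- (2 / (p - 1))) *
               (\<Sum>k = 0..nat \<lfloor>2 / (p - 1)\<rfloor>. a k * (1 - norm x) ^ k))
          \<in> o[filtercomap norm (at_left 1)](\<lambda>_. 1)"
  proof (intro exI[of _ a] allI impI smalloI_tendsto)
    fix u :: "real ^ 'n \<Rightarrow> real"
    assume u: "positive_large_solution (\<lambda>t. t powr p) u"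
    let ?S = "\<lambda>r. (1 - r) powr (- (2 / (p - 1))) * (\<Sum>k = 0..nat \<lfloor>2 / (p - 1)\<rfloor>. a k * (1 - r) ^ k)"
    have "eventually (\<lambda>r::real. r < 1) (at_left 1)" by (simp add: eventually_at_filter)
    hence "eventually (\<lambda>x::real ^ 'n. norm x < 1) (filtercomap norm (at_left 1))"
      by (rule eventually_filtercomapI)
    hence "eventually (\<lambda>x::real ^ 'n. U (norm x) - ?S (norm x) = u x - ?S (norm x)) (filtercomap norm (at_left 1))"
    proof eventually_elim
      case (elim x)
      thus ?case using positive_large_solution_radial[OF assms U u, of x] by simp
    qed
    moreover have "((\<lambda>x::real ^ 'n. U (norm x) - ?S (norm x)) \<longlongrightarrow> 0) (filtercomap norm (at_left 1))"
      by (rule filterlim_compose[OF a filterlim_filtercomap])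
    ultimately have "((\<lambda>x. u x - ?S (norm x)) \<longlongrightarrow> 0) (filtercomap norm (at_left 1))"
      by (rule Lim_transform_eventually[rotated])
    thus "((\<lambda>x. (u x - ?S (norm x)) / 1) \<longlongrightarrow> 0) (filtercomap norm (at_left 1))" by simp
  qed simp
qed

end
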